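(* For each dimension $n \ge 1$ there is a constant $c_n > 0$, depending only on $n$, such that the following holds. Let $g$ be any Riemannian metric on the $n$-dimensional torus $T^n$, and let $R$ be a real number with $0 < R < \tfrac12 \mathrm{Sys}(T^n,g)$. Then there is a point $x \in T^n$ such that the metric ball $B(x,R)$ satisfies $$|B(x,R)| \ge c_n R^n .$$
   Context: $\mathrm{Sys}(T^n,g)$ denotes the shortest length of a non-contractible closed curve in $(T^n,g)$. $B(x,R)$ denotes the ball of radius $R$ around $x$ with respect to the Riemannian distance of $g$, and $|B(x,R)|$ denotes its $n$-dimensional Riemannian volume. *)

theory Defs
  imports "HOL-Analysis.Analysis"
begin

text \<open>
  The torus \<open>T\<^sup>n\<close> is the product of \<open>n\<close> unit circles, a subset of \<open>\<complex>\<^sup>n\<close>, with its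
  standard smooth structure, for which the covering map \<open>torus_map\<close> from \<open>\<real>\<^sup>n\<close> is a
  local diffeomorphism.
\<close>

definition torus :: "(complex ^ 'n) set" where
  "torus = {z. \<forall>i. norm (z $ i) = 1}"

definition torus_map :: "real ^ 'n \<Rightarrow> complex ^ 'n" where
  "torus_map x = (\<chi> i. cis (x $ i))"

text \<open>The real inner product of \<open>\<complex>\<close> is used in each coordinate.\<close>

definition torus_tangent :: "complex ^ 'n \<Rightarrow> (complex ^ 'n) set" where
  "torus_tangent z = {v. \<forall>i. z $ i \<bullet> v $ i = 0}"

text \<open>
  \<open>torus_frame z i\<close> is the coordinate vector field of the \<open>i\<close>-th angle; see
  \<open>has_derivative_torus_map\<close> below.
\<close>

definition torus_frame :: "complex ^ 'n \<Rightarrow> 'n \<Rightarrow> complex ^ 'n" where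
  "torus_frame z i = axis i (\<i> * z $ i)"

fun Ck :: "nat \<Rightarrow> (real ^ 'n \<Rightarrow> real) \<Rightarrow> bool" where
  "Ck 0 f \<longleftrightarrow> continuous_on UNIV f"
| "Ck (Suc k) f \<longleftrightarrow> (\<forall>x. f differentiable (at x)) \<and>
     (\<forall>i. Ck k (\<lambda>x. frechet_derivative f (at x) (axis i 1)))"

definition smooth :: "(real ^ 'n \<Rightarrow> real) \<Rightarrow> bool" where
  "smooth f \<longleftrightarrow> (\<forall>k. Ck k f)"

text \<open>
  A field of bilinear forms \<open>g\<close> assigns to a point \<open>z\<close> and tangent vectors \<open>u\<close>, \<open>v\<close> at \<open>z\<close>
  the number \<open>g z u v\<close>; its values at other arguments are irrelevant.
\<close>

type_synonym 'n form_field = "complex ^ 'n \<Rightarrow> complex ^ 'n \<Rightarrow> complex ^ 'n \<Rightarrow> real"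

definition gram :: "'n form_field \<Rightarrow> complex ^ 'n \<Rightarrow> real ^ 'n ^ 'n" where
  "gram g z = (\<chi> i j. g z (torus_frame z i) (torus_frame z j))"

definition inner_product_on :: "'a::real_vector set \<Rightarrow> ('a \<Rightarrow> 'a \<Rightarrow> real) \<Rightarrow> bool" where
  "inner_product_on V b \<longleftrightarrow>
     (\<forall>u\<in>V. \<forall>v\<in>V. b u v = b v u) \<and>
     (\<forall>u\<in>V. \<forall>v\<in>V. \<forall>w\<in>V. b (u + v) w = b u w + b v w) \<and>
     (\<forall>c. \<forall>u\<in>V. \<forall>w\<in>V. b (c *\<^sub>R u) w = c * b u w) \<and>
     (\<forall>v\<in>V. v \<noteq> 0 \<longrightarrow> b v v > 0)"

definition riemannian_metric :: "('n::finite) form_field \<Rightarrow> bool" where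
  "riemannian_metric g \<longleftrightarrow>
     (\<forall>z\<in>torus. inner_product_on (torus_tangent z) (g z)) \<and>
     (\<forall>i j. smooth (\<lambda>x. gram g (torus_map x) $ i $ j))"

text \<open>
  Curves are piecewise \<open>C\<^sup>1\<close> in the sense of \<open>valid_path\<close>. That notion does not bound the
  derivative near the finitely many exceptional points, so a curve can have infinite length;
  lengths are therefore extended nonnegative reals.
\<close>

definition torus_curve :: "(real \<Rightarrow> complex ^ 'n) \<Rightarrow> bool" where
  "torus_curve \<gamma> \<longleftrightarrow> valid_path \<gamma> \<and> path_image \<gamma> \<subseteq> torus"

definition curve_length :: "('n::finite) form_field \<Rightarrow> (real \<Rightarrow> complex ^ 'n) \<Rightarrow> ennreal" where
  "curve_length g \<gamma> =
     (\<integral>\<^sup>+t\<in>{0..1}. ennreal (sqrt (g (\<gamma> t) (vector_derivative \<gamma> (at t)) (vector_derivative \<gamma> (at t))))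
        \<partial>lborel)"

definition contractible_loop :: "(real \<Rightarrow> complex ^ 'n) \<Rightarrow> bool" where
  "contractible_loop \<gamma> \<longleftrightarrow> (\<exists>a. homotopic_loops torus \<gamma> (linepath a a))"

definition systole :: "('n::finite) form_field \<Rightarrow> ennreal" where
  "systole g = Inf {curve_length g \<gamma> | \<gamma>.
     torus_curve \<gamma> \<and> pathfinish \<gamma> = pathstart \<gamma> \<and> \<not> contractible_loop \<gamma>}"

definition riemannian_dist ::
    "('n::finite) form_field \<Rightarrow> complex ^ 'n \<Rightarrow> complex ^ 'n \<Rightarrow> ennreal" where
  "riemannian_dist g x y = Inf {curve_length g \<gamma> | \<gamma>.
     torus_curve \<gamma> \<and> pathstart \<gamma> = x \<and> pathfinish \<gamma> = y}"

definition riemannian_ball ::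
    "('n::finite) form_field \<Rightarrow> complex ^ 'n \<Rightarrow> real \<Rightarrow> (complex ^ 'n) set" where
  "riemannian_ball g x R = {y \<in> torus. riemannian_dist g x y < ennreal R}"

text \<open>
  The volume is computed in the angular coordinates \<open>x \<in> [0, 2\<pi>)\<^sup>n\<close>, which parametrise the
  torus bijectively.
\<close>

definition riemannian_volume :: "('n::finite) form_field \<Rightarrow> (complex ^ 'n) set \<Rightarrow> ennreal" where
  "riemannian_volume g A =
     (\<integral>\<^sup>+x\<in>{x. (\<forall>i. 0 \<le> x $ i \<and> x $ i < 2 * pi) \<and> torus_map x \<in> A}.
        ennreal (sqrt (det (gram g (torus_map x)))) \<partial>(lborel :: (real ^ 'n) measure))"

lemma has_derivative_torus_map:
  fixes x :: "real ^ 'n"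
  shows "(torus_map has_derivative (\<lambda>v. \<Sum>i\<in>UNIV. v $ i *\<^sub>R torus_frame (torus_map x) i)) (at x)"
proof -
  have cis': "((\<lambda>y::real^'n. cis (y $ i)) has_derivative (\<lambda>v. v $ i *\<^sub>R (\<i> * cis (x $ i)))) (at x)"
    for i
    by (rule has_derivative_cis, rule bounded_linear_imp_has_derivative, rule bounded_linear_vec_nth)
  have eq: "(\<Sum>i\<in>UNIV. v $ i *\<^sub>R torus_frame (torus_map x) i) = (\<chi> i. v $ i *\<^sub>R (\<i> * cis (x $ i)))"
    for v :: "real ^ 'n"
    by (simp add: vec_eq_iff torus_frame_def torus_map_def axis_def if_distrib if_distribR
        cong: if_cong)
  show ?thesis
    unfolding eq unfolding torus_map_def
  proof (subst has_derivative_componentwise_within, intro ballI)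
    fix b :: "complex ^ 'n"
    assume "b \<in> Basis"
    then obtain i u where b: "b = axis i u"
      by (auto simp: Basis_vec_def)
    show "((\<lambda>y. (\<chi> i. cis (y $ i)) \<bullet> b) has_derivative
        (\<lambda>v. (\<chi> i. v $ i *\<^sub>R (\<i> * cis (x $ i))) \<bullet> b)) (at x)"
      unfolding b inner_axis vec_lambda_beta
      by (rule bounded_linear.has_derivative[OF bounded_linear_inner_left cis'])
  qed
qed

lemma torus_frame_in_tangent: "torus_frame z i \<in> torus_tangent z"
  by (auto simp: torus_frame_def torus_tangent_def axis_def inner_complex_def)

end

theory Submission
  imports Defs "HOL-Complex_Analysis.Winding_Numbers"
begin

text \<open>
  The proof is a discrete version of the argument with nested minimal hypersurfaces. Lift the metric
  to \<open>\<real>\<^sup>n\<close>, fix a small \<open>\<delta>\<close>, and let \<open>V\<close> be a finite set in the torus that is \<open>\<delta>\<close>-separated and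
  meets every ball of radius \<open>2 * \<delta>\<close>. Its points are the vertices of a graph with edges between points at distance less than \<open>5 * \<delta>\<close>. Say that a set of
  vertices kills the direction \<open>i\<close> if no loop of edges in it winds around the \<open>i\<close>-th circle.

  Starting with \<open>V\<close>, choose for one direction after the other a smallest subset of the current set
  whose complement in it kills this direction. Since a ball of radius less than half the systole
  kills every direction, the part of the smaller set inside a ball could be replaced by the part of
  the larger set in a shell of thickness \<open>5 * \<delta>\<close> around the ball; minimality shows that this shell
  contains at least as many points of the larger set as the ball contains of the smaller one
  (\<open>exists_minimal_cut\<close>). Summing over \<open>N\<close> disjoint shells gains a factor \<open>N\<close> for each direction
  (\<open>exists_iterated_cut\<close>).

  After all \<open>n\<close> directions a vertex is left, because the vertices cannot be covered by \<open>n\<close> sets the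
  \<open>i\<close>-th of which kills the direction \<open>i\<close> (\<open>net_not_covered_by_killing_sets\<close>, which rests on
  Brouwer's fixed point theorem). So some ball of radius less than \<open>R\<close> contains at least \<open>N ^ n\<close>
  vertices, where \<open>N * \<delta>\<close> is a fixed multiple of \<open>R\<close>. The balls of radius \<open>\<delta> / 2\<close> around the vertices
  are disjoint and, as the metric is nearly constant at this scale, have volume at least a constant
  times \<open>\<delta> ^ n\<close> (\<open>packing_integral\<close>). Together they have volume at least a constant times
  \<open>(N * \<delta>) ^ n\<close>, that is, a constant times \<open>R ^ n\<close>.
\<close>

section \<open>A covering theorem for cubes\<close>

text \<open>
  A form of the Lebesgue covering theorem. Colour the points of \<open>\<real>\<^sup>n\<close> with the \<open>n\<close> coordinate
  directions and give each point a sign that is constant on equally coloured nearby points.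
  Then some colour has the wrong sign near or beyond one of its two faces of the cube
  \<open>[-L, L]\<^sup>n\<close>.
  Otherwise a partition of unity turns the signed colours into a continuous vector field on the
  cube that vanishes nowhere and that points inward on the boundary wherever the colour matches
  the face, against Brouwer's fixed point theorem.
\<close>

lemma no_separating_signed_colouring:
  fixes c :: "real ^ 'n \<Rightarrow> 'n::finite" and s :: "real ^ 'n \<Rightarrow> real"
  assumes \<eta>: "\<eta> > 0" and L: "L > 0"
    and s: "\<And>x. s x = 1 \<or> s x = -1"
    and const: "\<And>x y. dist x y < \<eta> \<Longrightarrow> c x = c y \<Longrightarrow> s x = s y"
    and low: "\<And>x. x $ c x \<le> -L + \<eta> \<Longrightarrow> s x = 1"
    and high: "\<And>x. x $ c x \<ge> L - \<eta> \<Longrightarrow> s x = -1"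
  shows False
proof -
  define K :: "(real ^ 'n) set" where "K = cbox (\<chi> i. -L) (\<chi> i. L)"
  have memK: "x \<in> K \<longleftrightarrow> (\<forall>i. -L \<le> x $ i \<and> x $ i \<le> L)" for x
    by (auto simp: K_def mem_box_cart)
  have "compact K" "convex K" by (auto simp: K_def)
  have "K \<noteq> {}" using L by (auto simp: set_eq_iff memK intro!: exI[of _ 0])
  have "\<exists>P. finite P \<and> K \<subseteq> (\<Union>p\<in>P. ball p (\<eta>/2))"
    using \<open>compact K\<close> \<eta> unfolding compact_eq_totally_bounded
    by (elim conjE allE[of _ "\<eta>/2"]) auto
  then obtain P where P: "finite P" "K \<subseteq> (\<Union>p\<in>P. ball p (\<eta>/2))" by blast
  define \<psi> where "\<psi> p x = max 0 (\<eta>/2 - dist x p)" for p x :: "real ^ 'n"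
  define F where "F i x = (\<Sum>p\<in>P. \<psi> p x * (if c p = i then s p else 0))" for i x
  \<comment> \<open>A fixed point of \<open>x + F x\<close>, clamped to the cube, would be a zero of \<open>F\<close> or lie on a face
    towards which \<open>F\<close> points.\<close>
  define f where "f x = (\<chi> i. max (-L) (min L (x $ i + F i x)))" for x :: "real ^ 'n"
  have "continuous_on K f"
    unfolding f_def F_def \<psi>_def by (intro continuous_intros)
  moreover have "f \<in> K \<rightarrow> K"
    using L by (auto simp: memK f_def)
  ultimately obtain x where x: "x \<in> K" "f x = x"
    using brouwer[OF \<open>compact K\<close> \<open>convex K\<close> \<open>K \<noteq> {}\<close>] by blast
  obtain p0 where p0: "p0 \<in> P" "dist p0 x < \<eta>/2" using P x by auto
  define i where "i = c p0"
  define T where "T = (\<Sum>p\<in>P. \<psi> p x * (if c p = i then 1 else 0))"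
  \<comment> \<open>All net points of colour \<open>i\<close> that contribute at \<open>x\<close> are close to \<open>p0\<close> and share its sign.\<close>
  have "F i x = (\<Sum>p\<in>P. s p0 * (\<psi> p x * (if c p = i then 1 else 0)))"
    unfolding F_def
  proof (rule sum.cong[OF refl])
    fix p assume "p \<in> P"
    show "\<psi> p x * (if c p = i then s p else 0) = s p0 * (\<psi> p x * (if c p = i then 1 else 0))"
    proof (cases "c p = i \<and> dist x p < \<eta>/2")
      case True
      then have "dist p p0 < \<eta>" using p0 dist_triangle[of p p0 x] by (simp add: dist_commute)
      then have "s p = s p0" using const True by (simp add: i_def)
      then show ?thesis by simp
    next
      case False
      then show ?thesis by (auto simp: \<psi>_def max_def)
    qed
  qed
  then have FT: "F i x = s p0 * T" by (simp add: T_def sum_distrib_left)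
  have "T > 0"
    unfolding T_def
  proof (rule sum_pos2[of _ p0])
    show "0 < \<psi> p0 x * (if c p0 = i then 1 else 0)" using p0 by (simp add: \<psi>_def i_def dist_commute)
  qed (use P p0 in \<open>auto simp: \<psi>_def\<close>)
  have xi: "x $ i = max (-L) (min L (x $ i + F i x))"
    using x(2) by (metis f_def vec_lambda_beta)
  have comp: "\<bar>p0 $ i - x $ i\<bar> \<le> \<eta>/2"
    using p0 component_le_norm_cart[of "p0 - x" i] by (simp add: dist_norm)
  have xb: "-L \<le> x $ i" "x $ i \<le> L" using x memK by auto
  show False
  proof (cases "s p0 = 1")
    case True
    then have "x $ i = L" using xi xb FT \<open>T > 0\<close> by (auto simp: max_def min_def split: if_splits)
    then have "p0 $ c p0 \<ge> L - \<eta>" using comp \<eta> unfolding i_def by linarith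
    then have "s p0 = -1" by (rule high)
    then show False using True by simp
  next
    case False
    then have "s p0 = -1" using s by blast
    then have "x $ i = -L" using xi xb FT \<open>T > 0\<close> by (auto simp: max_def min_def split: if_splits)
    then have "p0 $ c p0 \<le> -L + \<eta>" using comp \<eta> unfolding i_def by linarith
    then have "s p0 = 1" by (rule low)
    then show False using False by simp
  qed
qed

section \<open>Minimal cuts in labelled graphs\<close>

text \<open>
  Consider a graph whose edges carry labels in \<open>\<int>\<^sup>n\<close>; here \<open>adj v w m\<close> will say that
  \<open>v\<close> is close to the translate of \<open>w\<close> by \<open>m\<close>. A set of vertices kills the \<open>i\<close>-th
  direction if the \<open>i\<close>-th component of the labels is a coboundary on it, so that no loop in the
  set winds around the \<open>i\<close>-th circle: the \<open>i\<close>-th generator of the first cohomology restricts to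
  zero.
\<close>

definition kills :: "('a \<Rightarrow> 'a \<Rightarrow> int ^ 'n \<Rightarrow> bool) \<Rightarrow> 'n \<Rightarrow> 'a set \<Rightarrow> bool" where
  "kills adj i A \<longleftrightarrow> (\<exists>a::'a \<Rightarrow> int. \<forall>v\<in>A. \<forall>w\<in>A. \<forall>m. adj v w m \<longrightarrow> a v = a w + m $ i)"

text \<open>
  Balls \<open>B x r\<close> in such a graph, where an edge increases the distance from \<open>x\<close> by at most \<open>\<epsilon>\<close>
  and balls of radius at most \<open>R\<close> kill every direction.
\<close>

locale layered_graph =
  fixes adj :: "'a \<Rightarrow> 'a \<Rightarrow> int ^ 'n \<Rightarrow> bool"
    and B :: "'c \<Rightarrow> real \<Rightarrow> 'a set" and \<epsilon> R :: real
  assumes adj_sym: "adj v w m \<Longrightarrow> adj w v (- m)"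
    and \<epsilon>_pos: "\<epsilon> > 0"
    and B_mono: "r \<le> r' \<Longrightarrow> B x r \<subseteq> B x r'"
    and B_step: "v \<in> B x r \<Longrightarrow> adj v w m \<Longrightarrow> w \<in> B x (r + \<epsilon>)"
    and B_kills: "r \<le> R \<Longrightarrow> kills adj i (B x r)"
begin

text \<open>
  The stability inequality. Let \<open>Y\<close> be a smallest subset of \<open>Z\<close> whose complement in \<open>Z\<close> kills the
  \<open>i\<close>-th direction. Replacing the part of \<open>Y\<close> in a ball by the part of \<open>Z\<close> in the shell around
  the ball gives another such subset: its complement falls into a part inside the ball and a part
  outside the shell, which no edge joins. So the shell contains at least as many points of \<open>Z\<close>
  as the ball contains points of \<open>Y\<close>.
\<close>

lemma exists_minimal_cut:
  assumes "finite Z"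
  obtains Y where "Y \<subseteq> Z" "kills adj i (Z - Y)"
    "\<And>x r. r \<le> R \<Longrightarrow> card (Y \<inter> B x r) \<le> card (Z \<inter> (B x (r + \<epsilon>) - B x r))"
proof -
  let ?P = "\<lambda>Y. Y \<subseteq> Z \<and> kills adj i (Z - Y)"
  have "?P Z" by (simp add: kills_def)
  then have "?P (arg_min card ?P)" "\<forall>Y'. ?P Y' \<longrightarrow> card (arg_min card ?P) \<le> card Y'"
    using arg_min_nat_lemma[of ?P Z card] by blast+
  then obtain Y where Y: "Y \<subseteq> Z" "kills adj i (Z - Y)"
    and min: "\<And>Y'. Y' \<subseteq> Z \<Longrightarrow> kills adj i (Z - Y') \<Longrightarrow> card Y \<le> card Y'"
    by blast
  show ?thesis
  proof (rule that[OF Y])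
    fix x r assume r: "r \<le> R"
    let ?S = "Z \<inter> (B x (r + \<epsilon>) - B x r)"
    let ?Y' = "(Y - B x r) \<union> ?S"
    obtain a where a: "\<And>v w m. v \<in> Z - Y \<Longrightarrow> w \<in> Z - Y \<Longrightarrow> adj v w m \<Longrightarrow> a v = a w + m $ i"
      using Y(2) unfolding kills_def by blast
    obtain b where b: "\<And>v w m. v \<in> B x r \<Longrightarrow> w \<in> B x r \<Longrightarrow> adj v w m \<Longrightarrow> b v = b w + m $ i"
      using B_kills[OF r, of i x] unfolding kills_def by blast
    have "kills adj i (Z - ?Y')"
      unfolding kills_def
    proof (intro exI[of _ "\<lambda>v. if v \<in> B x r then b v else a v"] ballI allI impI)
      fix v w m assume vw: "v \<in> Z - ?Y'" "w \<in> Z - ?Y'" and adj: "adj v w m"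
      have "v \<in> B x r \<longleftrightarrow> w \<in> B x r"
        using vw B_step[OF _ adj, of x r] B_step[OF _ adj_sym[OF adj], of x r] by blast
      then show "(if v \<in> B x r then b v else a v) = (if w \<in> B x r then b w else a w) + m $ i"
        using a[OF _ _ adj] b[OF _ _ adj] vw by auto
    qed
    then have "card Y \<le> card ?Y'" using Y(1) by (intro min) auto
    also have "\<dots> \<le> card (Y - B x r) + card ?S" by (rule card_Un_le)
    finally have "card Y \<le> card (Y - B x r) + card ?S" .
    moreover have "card Y = card (Y - B x r) + card (Y \<inter> B x r)"
      using Y(1) assms by (metis card_Diff_subset_Int card_Int_Diff finite_Int finite_subset inf_commute add.commute)
    ultimately show "card (Y \<inter> B x r) \<le> card ?S" by linarith
  qed
qed

text \<open>
  Summing the stability inequality over \<open>N\<close> consecutive disjoint shells.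
\<close>

lemma exists_cut_with_decay:
  assumes "finite Z"
  obtains Y where "Y \<subseteq> Z" "kills adj i (Z - Y)"
    "\<And>x t N. t + real N * \<epsilon> \<le> R \<Longrightarrow> N * card (Y \<inter> B x t) \<le> card (Z \<inter> B x (t + real N * \<epsilon>))"
proof -
  obtain Y where Y: "Y \<subseteq> Z" "kills adj i (Z - Y)"
    and shell: "\<And>x r. r \<le> R \<Longrightarrow> card (Y \<inter> B x r) \<le> card (Z \<inter> (B x (r + \<epsilon>) - B x r))"
    using exists_minimal_cut[OF assms] by blast
  have "N * card (Y \<inter> B x t) \<le> card (Z \<inter> B x (t + real N * \<epsilon>))" if "t + real N * \<epsilon> \<le> R" for x t N
    using that
  proof (induction N)
    case (Suc N)
    let ?r = "t + real N * \<epsilon>"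
    have eq: "t + real (Suc N) * \<epsilon> = ?r + \<epsilon>" by (simp add: algebra_simps)
    have "?r \<le> R" using Suc.prems \<epsilon>_pos unfolding eq by linarith
    have fY: "finite (Y \<inter> B x ?r)" using Y(1) assms by (meson finite_Int finite_subset)
    have "card (Y \<inter> B x t) \<le> card (Y \<inter> B x ?r)"
      using B_mono[of t ?r x] \<epsilon>_pos by (intro card_mono fY) auto
    also have "\<dots> \<le> card (Z \<inter> (B x (?r + \<epsilon>) - B x ?r))" by (rule shell[OF \<open>?r \<le> R\<close>])
    finally have "Suc N * card (Y \<inter> B x t)
        \<le> card (Z \<inter> (B x (?r + \<epsilon>) - B x ?r)) + card (Z \<inter> B x ?r)"
      using Suc.IH[OF \<open>?r \<le> R\<close>] by simp
    also have "\<dots> = card (Z \<inter> (B x (?r + \<epsilon>) - B x ?r) \<union> Z \<inter> B x ?r)"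
      using assms by (intro card_Un_disjoint[symmetric]) auto
    also have "\<dots> \<le> card (Z \<inter> B x (?r + \<epsilon>))"
      using B_mono[of ?r "?r + \<epsilon>" x] \<epsilon>_pos assms by (intro card_mono) auto
    finally show ?case unfolding eq .
  qed simp
  with Y show ?thesis using that by blast
qed

text \<open>
  Cutting once for each direction in \<open>l\<close>: the vertices outside the final set \<open>Y\<close> are coloured by
  the direction that was killed when they were dropped, and each cut gains a factor \<open>N\<close>.
\<close>

lemma exists_iterated_cut:
  assumes "finite Z" "distinct l"
  shows "\<exists>Y c. Y \<subseteq> Z \<and> (\<forall>v\<in>Z - Y. c v \<in> set l) \<and> (\<forall>i\<in>set l. kills adj i {v \<in> Z - Y. c v = i}) \<and>
    (\<forall>x t N. t + real (length l) * (real N * \<epsilon>) \<le> R \<longrightarrow>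
       N ^ length l * card (Y \<inter> B x t) \<le> card (Z \<inter> B x (t + real (length l) * (real N * \<epsilon>))))"
  using assms
proof (induction l arbitrary: Z)
  case Nil
  then show ?case by auto
next
  case (Cons i l)
  obtain Z' where Z': "Z' \<subseteq> Z" "kills adj i (Z - Z')"
    and decay: "\<And>x t N. t + real N * \<epsilon> \<le> R \<Longrightarrow> N * card (Z' \<inter> B x t) \<le> card (Z \<inter> B x (t + real N * \<epsilon>))"
    using exists_cut_with_decay[OF \<open>finite Z\<close>] by blast
  have "finite Z'" using Z'(1) Cons.prems finite_subset by blast
  from Cons.IH[OF this] Cons.prems obtain Y c where Y: "Y \<subseteq> Z'" and
    c: "\<forall>v\<in>Z' - Y. c v \<in> set l" "\<forall>j\<in>set l. kills adj j {v \<in> Z' - Y. c v = j}" and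
    IH: "\<And>x t N. t + real (length l) * (real N * \<epsilon>) \<le> R \<Longrightarrow>
       N ^ length l * card (Y \<inter> B x t) \<le> card (Z' \<inter> B x (t + real (length l) * (real N * \<epsilon>)))"
    by auto
  define c' where "c' v = (if v \<in> Z' then c v else i)" for v
  have "i \<notin> set l" using Cons.prems by simp
  have "\<forall>v\<in>Z - Y. c' v \<in> set (i # l)" using c(1) by (auto simp: c'_def)
  moreover have "kills adj j {v \<in> Z - Y. c' v = j}" if "j \<in> set (i # l)" for j
  proof (cases "j = i")
    case True
    have "{v \<in> Z - Y. c' v = i} = Z - Z'"
      using c(1) \<open>i \<notin> set l\<close> Y by (auto simp: c'_def split: if_splits)
    then show ?thesis using Z'(2) True by simp
  next
    case False
    then have "{v \<in> Z - Y. c' v = j} = {v \<in> Z' - Y. c v = j}"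
      using Z'(1) by (auto simp: c'_def split: if_splits)
    then show ?thesis using c(2) that False by simp
  qed
  moreover have "N ^ length (i # l) * card (Y \<inter> B x t)
      \<le> card (Z \<inter> B x (t + real (length (i # l)) * (real N * \<epsilon>)))"
    if "t + real (length (i # l)) * (real N * \<epsilon>) \<le> R" for x t N
  proof -
    let ?t = "t + real (length l) * (real N * \<epsilon>)"
    have eq: "t + real (length (i # l)) * (real N * \<epsilon>) = ?t + real N * \<epsilon>" by (simp add: algebra_simps)
    have "0 \<le> real N * \<epsilon>" using \<epsilon>_pos by simp
    then have "?t \<le> R" using that unfolding eq by linarith
    from IH[OF this] have "N ^ length (i # l) * card (Y \<inter> B x t) \<le> N * card (Z' \<inter> B x ?t)"
      by (simp add: mult.assoc)
    also have "\<dots> \<le> card (Z \<inter> B x (?t + real N * \<epsilon>))"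
      using that unfolding eq by (rule decay)
    finally show ?thesis unfolding eq .
  qed
  ultimately show ?case using Y Z'(1) by (intro exI[of _ Y] exI[of _ c']) auto
qed

end

section \<open>Lengths of curves for periodic metrics\<close>

text \<open>
  The deck transformation of the covering \<open>torus_map\<close> that belongs to \<open>m \<in> \<int>\<^sup>n\<close> is the
  translation by \<open>lat m\<close>.
\<close>

definition lat :: "int ^ 'n \<Rightarrow> real ^ 'n" where
  "lat m = (\<chi> i. 2 * pi * of_int (m $ i))"

lemma lat_simps [simp]: "lat 0 = 0" "lat (m + k) = lat m + lat k" "lat (- m) = - lat m"
    "lat (m - k) = lat m - lat k"
  by (simp_all add: lat_def vec_eq_iff algebra_simps)

lemma torus_map_lat [simp]: "torus_map (x + lat m) = torus_map x"
proof -
  have "cis (2 * (pi * of_int k)) = 1" for k :: int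
    using cis_multiple_2pi[of "of_int k"] by (simp add: mult.assoc)
  then show ?thesis by (simp add: torus_map_def lat_def vec_eq_iff cis_mult[symmetric] mult.assoc)
qed

lemma torus_map_in_torus [simp]: "torus_map x \<in> torus"
  by (simp add: torus_map_def torus_def)

text \<open>
  A Riemannian metric on \<open>\<real>\<^sup>n\<close> is represented by its matrix field \<open>G\<close>; \<open>speed G x u\<close> is the length
  of the tangent vector \<open>u\<close> at \<open>x\<close>.
\<close>

definition speed :: "(real ^ 'n \<Rightarrow> real ^ 'n ^ 'n) \<Rightarrow> real ^ 'n \<Rightarrow> real ^ 'n \<Rightarrow> real" where
  "speed G x u = sqrt (u \<bullet> (G x *v u))"

definition lifted_length :: "(real ^ 'n \<Rightarrow> real ^ 'n ^ 'n) \<Rightarrow> (real \<Rightarrow> real ^ 'n) \<Rightarrow> ennreal" where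
  "lifted_length G \<gamma> =
     (\<integral>\<^sup>+t\<in>{0..1}. ennreal (speed G (\<gamma> t) (vector_derivative \<gamma> (at t))) \<partial>lborel)"

text \<open>
  \<open>near G r x y\<close> says that the Riemannian distance of \<open>x\<close> and \<open>y\<close> is less than \<open>r\<close>. Stated through
  a connecting curve, it needs no infimum.
\<close>

definition near :: "(real ^ 'n \<Rightarrow> real ^ 'n ^ 'n) \<Rightarrow> real \<Rightarrow> real ^ 'n \<Rightarrow> real ^ 'n \<Rightarrow> bool" where
  "near G r x y \<longleftrightarrow> (\<exists>\<gamma>. valid_path \<gamma> \<and> pathstart \<gamma> = x \<and> pathfinish \<gamma> = y \<and>
     lifted_length G \<gamma> < ennreal r)"

lemma speed_scaleR: "speed G x (a *\<^sub>R u) = \<bar>a\<bar> * speed G x u"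
  by (simp add: speed_def matrix_vector_mult_scaleR real_sqrt_mult flip: mult.assoc)

lemma speed_minus: "speed G x (- u) = speed G x u"
  using speed_scaleR[of G x "-1" u] by simp

lemma finite_AE_lborel: "finite S \<Longrightarrow> AE t::real in lborel. t \<notin> S"
  by (intro AE_not_in) (auto simp: finite_imp_null_set_lborel)

text \<open>
  The derivative of a piecewise \<open>C\<^sup>1\<close> curve only matters off a finite set.
\<close>

lemma lifted_length_eq:
  assumes "finite S" "\<And>t. t \<in> {0..1} - S \<Longrightarrow> (\<gamma> has_vector_derivative D t) (at t)"
  shows "lifted_length G \<gamma> =
    (\<integral>\<^sup>+t. indicator ({0..1} - S) t * ennreal (speed G (\<gamma> t) (D t)) \<partial>lborel)"
  unfolding lifted_length_def
proof (rule nn_integral_cong_AE)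
  show "AE t in lborel. ennreal (speed G (\<gamma> t) (vector_derivative \<gamma> (at t))) * indicator {0..1} t
      = indicator ({0..1} - S) t * ennreal (speed G (\<gamma> t) (D t))"
    using finite_AE_lborel[OF assms(1)]
  proof eventually_elim
    case (elim t)
    then show ?case
      using vector_derivative_at[OF assms(2), of t] by (auto split: split_indicator)
  qed
qed

lemma valid_path_derivative:
  assumes "valid_path \<gamma>"
  obtains S D where "finite S" "\<And>t. t \<in> {0..1} - S \<Longrightarrow> (\<gamma> has_vector_derivative D t) (at t)"
    "continuous_on ({0..1} - S) D" "continuous_on {0..1} \<gamma>"
  using assms unfolding valid_path_def piecewise_C1_differentiable_on_def C1_differentiable_on_def
  by blast

lemma has_vector_derivative_affine:
  assumes "(\<gamma> has_vector_derivative D) (at (a + b * t))"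
  shows "((\<lambda>t. \<gamma> (a + b * t)) has_vector_derivative b *\<^sub>R D) (at t)"
proof -
  have "((\<lambda>t. a + b * t) has_vector_derivative b) (at t)"
    by (auto intro!: derivative_eq_intros simp: has_real_derivative_iff_has_vector_derivative[symmetric])
  from vector_diff_chain_at[OF this assms] show ?thesis by (simp add: o_def)
qed

text \<open>
  The matrix fields on \<open>\<real>\<^sup>n\<close> that come from continuous Riemannian metrics on the torus. No more
  regularity than continuity is needed.
\<close>

locale periodic_metric =
  fixes G :: "real ^ 'n::finite \<Rightarrow> real ^ 'n ^ 'n"
  assumes cont: "continuous_on UNIV G"
    and sym: "transpose (G x) = G x"
    and pos: "u \<noteq> 0 \<Longrightarrow> u \<bullet> (G x *v u) > 0"
    and periodic [simp]: "G (x + lat m) = G x"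
begin

lemma continuous_speed:
  assumes "continuous_on A \<gamma>" "continuous_on A D"
  shows "continuous_on A (\<lambda>t. speed G (\<gamma> t) (D t))"
proof -
  have "continuous_on A (\<lambda>t. G (\<gamma> t))"
    using continuous_on_compose2[OF cont assms(1)] by simp
  then have "continuous_on A (\<lambda>t. G (\<gamma> t) *v D t)"
    unfolding matrix_vector_mult_def using assms(2) by (intro continuous_intros)
  then show ?thesis unfolding speed_def using assms(2) by (intro continuous_intros)
qed

lemma measurable_speed:
  assumes "finite S" "continuous_on ({0..1} - S) D" "continuous_on {0..1} \<gamma>"
  shows "(\<lambda>t::real. indicator ({0..1} - S) t * ennreal (speed G (\<gamma> t) (D t))) \<in> borel_measurable borel"
proof -
  have "continuous_on ({0..1} - S) (\<lambda>t. speed G (\<gamma> t) (D t))"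
    using assms by (intro continuous_speed) (auto intro: continuous_on_subset)
  moreover have "{0..1} - S \<in> sets borel"
    using finite_imp_closed[OF assms(1)] by auto
  ultimately have "(\<lambda>t. indicator ({0..1} - S) t *\<^sub>R speed G (\<gamma> t) (D t)) \<in> borel_measurable borel"
    by (intro borel_measurable_continuous_on_indicator) auto
  then have "(\<lambda>t. ennreal (indicator ({0..1} - S) t *\<^sub>R speed G (\<gamma> t) (D t))) \<in> borel_measurable borel"
    by measurable
  also have "(\<lambda>t. ennreal (indicator ({0..1} - S) t *\<^sub>R speed G (\<gamma> t) (D t))) =
     (\<lambda>t. indicator ({0..1} - S) t * ennreal (speed G (\<gamma> t) (D t)))"
    by (auto split: split_indicator)
  finally show ?thesis .
qed

lemma lifted_length_join:
  assumes "valid_path \<gamma>1" "valid_path \<gamma>2"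
  shows "lifted_length G (\<gamma>1 +++ \<gamma>2) = lifted_length G \<gamma>1 + lifted_length G \<gamma>2"
proof -
  obtain S1 D1 where 1: "finite S1" "\<And>t. t \<in> {0..1} - S1 \<Longrightarrow> (\<gamma>1 has_vector_derivative D1 t) (at t)"
    "continuous_on ({0..1} - S1) D1" "continuous_on {0..1} \<gamma>1"
    using valid_path_derivative[OF assms(1)] by blast
  obtain S2 D2 where 2: "finite S2" "\<And>t. t \<in> {0..1} - S2 \<Longrightarrow> (\<gamma>2 has_vector_derivative D2 t) (at t)"
    "continuous_on ({0..1} - S2) D2" "continuous_on {0..1} \<gamma>2"
    using valid_path_derivative[OF assms(2)] by blast
  define S where "S = (\<lambda>t. t / 2) ` S1 \<union> (\<lambda>t. (t + 1) / 2) ` S2 \<union> {1/2}"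
  define D where "D t = (if t < 1/2 then 2 *\<^sub>R D1 (2 * t) else 2 *\<^sub>R D2 (2 * t - 1))" for t
  have "finite S" using 1 2 by (simp add: S_def)
  have S1: "2 * t \<notin> S1" if "t \<notin> S" for t
    using that imageI[of "2 * t" S1 "\<lambda>t. t / 2"] by (auto simp: S_def)
  have S2: "2 * t - 1 \<notin> S2" if "t \<notin> S" for t
    using that imageI[of "2 * t - 1" S2 "\<lambda>t. (t + 1) / 2"] by (auto simp: S_def)
  have Sh: "t \<noteq> 1/2" if "t \<notin> S" for t
    using that by (auto simp: S_def)
  have D: "((\<gamma>1 +++ \<gamma>2) has_vector_derivative D t) (at t)" if t: "t \<in> {0..1} - S" for t
  proof (cases "t < 1/2")
    case True
    have "((\<lambda>t. \<gamma>1 (2 * t)) has_vector_derivative D t) (at t)"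
      using has_vector_derivative_affine[of \<gamma>1 "D1 (2 * t)" 0 2 t] 1(2)[of "2 * t"] S1[of t] t True
      by (auto simp: D_def)
    then show ?thesis
      by (rule has_vector_derivative_transform_within_open[of _ _ _ "{..<1/2}"])
        (use True in \<open>auto simp: joinpaths_def\<close>)
  next
    case False
    then have "t > 1/2" using Sh t by force
    have "((\<lambda>t. \<gamma>2 (2 * t - 1)) has_vector_derivative D t) (at t)"
      using has_vector_derivative_affine[of \<gamma>2 "D2 (2 * t - 1)" "-1" 2 t] 2(2)[of "2 * t - 1"] S2[of t] t False
      by (auto simp: D_def)
    then show ?thesis
      by (rule has_vector_derivative_transform_within_open[of _ _ _ "{1/2<..}"])
        (use \<open>t > 1/2\<close> in \<open>auto simp: joinpaths_def\<close>)
  qed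
  define f1 where "f1 t = indicator ({0..1} - S1) t * ennreal (speed G (\<gamma>1 t) (D1 t))" for t :: real
  define f2 where "f2 t = indicator ({0..1} - S2) t * ennreal (speed G (\<gamma>2 t) (D2 t))" for t :: real
  have m1 [measurable]: "f1 \<in> borel_measurable borel" and m2 [measurable]: "f2 \<in> borel_measurable borel"
    using measurable_speed 1 2 unfolding f1_def f2_def by blast+
  have "lifted_length G (\<gamma>1 +++ \<gamma>2)
      = (\<integral>\<^sup>+t. indicator ({0..1} - S) t * ennreal (speed G ((\<gamma>1 +++ \<gamma>2) t) (D t)) \<partial>lborel)"
    by (rule lifted_length_eq[OF \<open>finite S\<close> D])
  also have "\<dots> = (\<integral>\<^sup>+t. 2 * f1 (0 + 2 * t) + 2 * f2 (-1 + 2 * t) \<partial>lborel)"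
  proof (rule nn_integral_cong_AE)
    show "AE t in lborel. indicator ({0..1} - S) t * ennreal (speed G ((\<gamma>1 +++ \<gamma>2) t) (D t))
        = 2 * f1 (0 + 2 * t) + 2 * f2 (-1 + 2 * t)"
      using finite_AE_lborel[OF \<open>finite S\<close>]
    proof eventually_elim
      case (elim t)
      show ?case
        using S1[OF elim] S2[OF elim] Sh[OF elim] elim
        by (auto simp: f1_def f2_def D_def joinpaths_def speed_scaleR ennreal_mult' split: split_indicator)
    qed
  qed
  also have "\<dots> = (\<integral>\<^sup>+t. f1 t \<partial>lborel) + (\<integral>\<^sup>+t. f2 t \<partial>lborel)"
    by (simp add: nn_integral_add nn_integral_cmult nn_integral_real_affine[of f1 2 0]
        nn_integral_real_affine[of f2 2 "-1"])
  also have "(\<integral>\<^sup>+t. f1 t \<partial>lborel) = lifted_length G \<gamma>1"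
    unfolding f1_def by (rule lifted_length_eq[symmetric]) (use 1 in auto)
  also have "(\<integral>\<^sup>+t. f2 t \<partial>lborel) = lifted_length G \<gamma>2"
    unfolding f2_def by (rule lifted_length_eq[symmetric]) (use 2 in auto)
  finally show ?thesis .
qed

lemma lifted_length_reversepath:
  assumes "valid_path \<gamma>"
  shows "lifted_length G (reversepath \<gamma>) = lifted_length G \<gamma>"
proof -
  obtain S D where 1: "finite S" "\<And>t. t \<in> {0..1} - S \<Longrightarrow> (\<gamma> has_vector_derivative D t) (at t)"
    "continuous_on ({0..1} - S) D" "continuous_on {0..1} \<gamma>"
    using valid_path_derivative[OF assms(1)] by blast
  define f where "f t = indicator ({0..1} - S) t * ennreal (speed G (\<gamma> t) (D t))" for t :: real
  have m [measurable]: "f \<in> borel_measurable borel"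
    using measurable_speed 1 unfolding f_def by blast
  have mem: "1 - t \<in> {0..1} - S \<longleftrightarrow> t \<in> {0..1} - (\<lambda>t. 1 - t) ` S" for t :: real
    by (auto simp: image_iff)
  have "lifted_length G (reversepath \<gamma>) = (\<integral>\<^sup>+t. indicator ({0..1} - (\<lambda>t. 1 - t) ` S) t *
      ennreal (speed G (reversepath \<gamma> t) (- D (1 - t))) \<partial>lborel)"
  proof (rule lifted_length_eq)
    fix t assume "t \<in> {0..1} - (\<lambda>t. 1 - t) ` S"
    then show "(reversepath \<gamma> has_vector_derivative - D (1 - t)) (at t)"
      using has_vector_derivative_affine[of \<gamma> "D (1 - t)" 1 "-1" t] 1(2)[of "1 - t"] mem[of t]
      by (auto simp: reversepath_def)
  qed (simp add: 1)
  also have "\<dots> = (\<integral>\<^sup>+t. f (1 + (-1) * t) \<partial>lborel)"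
    using mem by (intro nn_integral_cong) (auto simp: f_def reversepath_def speed_minus
        split: split_indicator)
  also have "\<dots> = (\<integral>\<^sup>+t. f t \<partial>lborel)"
    using nn_integral_real_affine[of f "-1" 1] by simp
  also have "\<dots> = lifted_length G \<gamma>"
    unfolding f_def by (rule lifted_length_eq[symmetric]) (use 1 in auto)
  finally show ?thesis .
qed

lemma lifted_length_linepath_le:
  assumes "\<And>z. z \<in> closed_segment x y \<Longrightarrow> speed G z (y - x) \<le> b"
  shows "lifted_length G (linepath x y) \<le> ennreal b"
proof -
  have "lifted_length G (linepath x y) \<le> (\<integral>\<^sup>+t\<in>{0..1::real}. ennreal b \<partial>lborel)"
    unfolding lifted_length_def
    by (rule nn_integral_mono)
      (auto simp: linepath_in_path intro!: ennreal_leI assms split: split_indicator)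
  then show ?thesis by (simp add: nn_integral_cmult)
qed

lemma near_linepath:
  assumes "\<And>z. z \<in> closed_segment x y \<Longrightarrow> speed G z (y - x) \<le> b" "b < r" "0 < r"
  shows "near G r x y"
  unfolding near_def
proof (intro exI conjI)
  show "lifted_length G (linepath x y) < ennreal r"
    using lifted_length_linepath_le[OF assms(1)] assms(2,3) by (meson ennreal_lessI le_less_trans)
qed auto

lemma near_refl: "0 < r \<Longrightarrow> near G r x x"
  by (rule near_linepath[where b = 0]) (auto simp: speed_def)

lemma near_sym: "near G r x y \<Longrightarrow> near G r y x"
  unfolding near_def by (metis lifted_length_reversepath valid_path_reversepath
      pathstart_reversepath pathfinish_reversepath)

lemma near_mono: "near G r x y \<Longrightarrow> r \<le> s \<Longrightarrow> near G s x y"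
  unfolding near_def using order.strict_trans2[OF _ ennreal_leI] by blast

lemma near_trans:
  assumes "near G r x y" "near G s y z"
  shows "near G (r + s) x z"
proof -
  obtain \<gamma>1 where 1: "valid_path \<gamma>1" "pathstart \<gamma>1 = x" "pathfinish \<gamma>1 = y" "lifted_length G \<gamma>1 < ennreal r"
    using assms(1) unfolding near_def by blast
  obtain \<gamma>2 where 2: "valid_path \<gamma>2" "pathstart \<gamma>2 = y" "pathfinish \<gamma>2 = z" "lifted_length G \<gamma>2 < ennreal s"
    using assms(2) unfolding near_def by blast
  have "r > 0" "s > 0" using le_less_trans[OF zero_le 1(4)] le_less_trans[OF zero_le 2(4)] by simp_all
  then have "lifted_length G (\<gamma>1 +++ \<gamma>2) < ennreal (r + s)"
    using 1 2 by (simp add: lifted_length_join ennreal_plus add_strict_mono)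
  then show ?thesis
    unfolding near_def using 1 2 by (intro exI[of _ "\<gamma>1 +++ \<gamma>2"]) (auto intro: valid_path_join)
qed

lemma near_lat:
  assumes "near G r x y"
  shows "near G r (x + lat m) (y + lat m)"
proof -
  obtain \<gamma> where 1: "valid_path \<gamma>" "pathstart \<gamma> = x" "pathfinish \<gamma> = y" "lifted_length G \<gamma> < ennreal r"
    using assms(1) unfolding near_def by blast
  obtain S D where 2: "finite S" "\<And>t. t \<in> {0..1} - S \<Longrightarrow> (\<gamma> has_vector_derivative D t) (at t)"
    "continuous_on ({0..1} - S) D" "continuous_on {0..1} \<gamma>"
    using valid_path_derivative[OF 1(1)] by blast
  let ?\<gamma>' = "\<lambda>t. \<gamma> t - lat (- m)"
  have "lifted_length G ?\<gamma>' =
      (\<integral>\<^sup>+t. indicator ({0..1} - S) t * ennreal (speed G (?\<gamma>' t) (D t)) \<partial>lborel)"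
  proof (rule lifted_length_eq[where \<gamma> = ?\<gamma>' and D = D and S = S, OF 2(1)])
    show "(?\<gamma>' has_vector_derivative D t) (at t)" if "t \<in> {0..1} - S" for t
      using has_vector_derivative_diff[OF 2(2)[OF that] has_vector_derivative_const[of "lat (- m)"]] by simp
  qed
  also have "\<dots> = (\<integral>\<^sup>+t. indicator ({0..1} - S) t * ennreal (speed G (\<gamma> t) (D t)) \<partial>lborel)"
    by (simp add: speed_def)
  also have "\<dots> = lifted_length G \<gamma>"
    by (rule lifted_length_eq[symmetric]) (use 2 in auto)
  finally have "lifted_length G ?\<gamma>' = lifted_length G \<gamma>" .
  moreover have "valid_path ?\<gamma>'" using 1(1) by (rule valid_path_offset[THEN iffD2])
  ultimately show ?thesis
    unfolding near_def using 1
    by (intro exI[of _ ?\<gamma>']) (auto simp: pathstart_def pathfinish_def)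
qed

end

section \<open>Projection to the torus and the systole\<close>

lemma inner_product_on_sum:
  assumes "inner_product_on V b" "subspace V" "finite I" "\<And>i. i \<in> I \<Longrightarrow> f i \<in> V" "w \<in> V"
  shows "b (\<Sum>i\<in>I. c i *\<^sub>R f i) w = (\<Sum>i\<in>I. c i * b (f i) w)"
  using assms(3,4)
proof (induction I rule: finite_induct)
  case empty
  have "b (0 *\<^sub>R 0) w = 0 * b 0 w"
    using assms(1,5) subspace_0[OF assms(2)] unfolding inner_product_on_def by blast
  then show ?case by simp
next
  case (insert j I)
  have "(\<Sum>i\<in>I. c i *\<^sub>R f i) \<in> V" "c j *\<^sub>R f j \<in> V"
    using insert.prems assms(2) by (auto intro!: subspace_sum subspace_scale)
  then have "b (c j *\<^sub>R f j + (\<Sum>i\<in>I. c i *\<^sub>R f i)) w = c j * b (f j) w + b (\<Sum>i\<in>I. c i *\<^sub>R f i) w"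
    using assms(1,5) insert.prems unfolding inner_product_on_def by auto
  then show ?case using insert by simp
qed

lemma subspace_torus_tangent: "subspace (torus_tangent z)"
  by (auto simp: subspace_def torus_tangent_def inner_add_right)

text \<open>
  The pullback of \<open>g\<close> to \<open>\<real>\<^sup>n\<close>, in the basis given by the angular coordinates.
\<close>

definition lifted_metric :: "('n::finite) form_field \<Rightarrow> real ^ 'n \<Rightarrow> real ^ 'n ^ 'n" where
  "lifted_metric g x = gram g (torus_map x)"

context
  fixes g :: "('n::finite) form_field"
  assumes g: "riemannian_metric g"
begin

lemma metric_on_frame_combinations:
  assumes z: "z \<in> torus"
  shows "g z (\<Sum>i\<in>UNIV. u $ i *\<^sub>R torus_frame z i) (\<Sum>j\<in>UNIV. v $ j *\<^sub>R torus_frame z j)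
    = u \<bullet> (gram g z *v v)"
proof -
  let ?V = "torus_tangent z"
  have ip: "inner_product_on ?V (g z)" using g z by (simp add: riemannian_metric_def)
  have sym: "g z a b = g z b a" if "a \<in> ?V" "b \<in> ?V" for a b
    using ip that unfolding inner_product_on_def by blast
  have mem: "(\<Sum>i\<in>UNIV. w $ i *\<^sub>R torus_frame z i) \<in> ?V" for w
    using subspace_torus_tangent[of z] by (auto intro!: subspace_sum subspace_scale torus_frame_in_tangent)
  have "g z (\<Sum>i\<in>UNIV. u $ i *\<^sub>R torus_frame z i) (\<Sum>j\<in>UNIV. v $ j *\<^sub>R torus_frame z j)
     = (\<Sum>i\<in>UNIV. u $ i * g z (torus_frame z i) (\<Sum>j\<in>UNIV. v $ j *\<^sub>R torus_frame z j))"
    by (intro inner_product_on_sum[OF ip subspace_torus_tangent]) (simp_all add: torus_frame_in_tangent mem)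
  also have "\<dots> = (\<Sum>i\<in>UNIV. u $ i * g z (\<Sum>j\<in>UNIV. v $ j *\<^sub>R torus_frame z j) (torus_frame z i))"
    by (simp add: sym torus_frame_in_tangent mem)
  also have "\<dots> = (\<Sum>i\<in>UNIV. u $ i * (\<Sum>j\<in>UNIV. v $ j * g z (torus_frame z j) (torus_frame z i)))"
    by (subst inner_product_on_sum[OF ip subspace_torus_tangent]) (simp_all add: torus_frame_in_tangent)
  also have "\<dots> = u \<bullet> (gram g z *v v)"
    by (simp add: inner_vec_def matrix_vector_mult_def gram_def sym torus_frame_in_tangent mult.commute)
  finally show ?thesis .
qed

lemma frame_combination_eq_0_iff:
  assumes "z \<in> torus"
  shows "(\<Sum>i\<in>UNIV. u $ i *\<^sub>R torus_frame z i) = 0 \<longleftrightarrow> u = 0"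
proof -
  have "(\<Sum>i\<in>UNIV. u $ i *\<^sub>R torus_frame z i) $ j = u $ j *\<^sub>R (\<i> * z $ j)" for j
    by (simp add: torus_frame_def axis_def if_distrib if_distribR cong: if_cong)
  moreover have "z $ j \<noteq> 0" for j using assms by (auto simp: torus_def dest!: spec[of _ j])
  ultimately show ?thesis by (simp add: vec_eq_iff)
qed

lemma periodic_metric_lifted_metric: "periodic_metric (lifted_metric g)"
proof
  have "continuous_on UNIV (\<lambda>x. gram g (torus_map x) $ i $ j)" for i j
    using g Ck.simps(1) unfolding riemannian_metric_def smooth_def by blast
  then have "continuous_on UNIV (\<lambda>x. \<chi> i j. gram g (torus_map x) $ i $ j)"
    by (intro continuous_on_vec_lambda)
  then show "continuous_on UNIV (lifted_metric g)"
    unfolding lifted_metric_def by simp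
next
  fix x
  have ip: "inner_product_on (torus_tangent (torus_map x)) (g (torus_map x))"
    using g by (simp add: riemannian_metric_def)
  then show "transpose (lifted_metric g x) = lifted_metric g x"
    unfolding inner_product_on_def
    by (simp add: lifted_metric_def transpose_def vec_eq_iff gram_def torus_frame_in_tangent)
  fix u :: "real ^ 'n" assume "u \<noteq> 0"
  let ?w = "\<Sum>i\<in>UNIV. u $ i *\<^sub>R torus_frame (torus_map x) i"
  have "?w \<noteq> 0" using \<open>u \<noteq> 0\<close> frame_combination_eq_0_iff[of "torus_map x" u] by simp
  moreover have "?w \<in> torus_tangent (torus_map x)"
    using subspace_torus_tangent by (auto intro!: subspace_sum subspace_scale torus_frame_in_tangent)
  ultimately have "g (torus_map x) ?w ?w > 0"
    using ip unfolding inner_product_on_def by blast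
  then show "u \<bullet> (lifted_metric g x *v u) > 0"
    by (simp add: metric_on_frame_combinations lifted_metric_def)
qed (simp add: lifted_metric_def)

lemma continuous_on_torus_map: "continuous_on A (torus_map :: real ^ 'm \<Rightarrow> complex ^ 'm)"
  unfolding torus_map_def by (intro continuous_intros)

lemma projected_curve:
  fixes \<gamma> :: "real \<Rightarrow> real ^ 'n"
  assumes "valid_path \<gamma>"
  shows "torus_curve (torus_map \<circ> \<gamma>)" "curve_length g (torus_map \<circ> \<gamma>) = lifted_length (lifted_metric g) \<gamma>"
proof -
  obtain S D where S: "finite S" "\<And>t. t \<in> {0..1} - S \<Longrightarrow> (\<gamma> has_vector_derivative D t) (at t)"
    "continuous_on ({0..1} - S) D" "continuous_on {0..1} \<gamma>"
    using valid_path_derivative[OF assms] by blast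
  define D' where "D' t = (\<Sum>i\<in>UNIV. D t $ i *\<^sub>R torus_frame (torus_map (\<gamma> t)) i)" for t
  have D': "((torus_map \<circ> \<gamma>) has_vector_derivative D' t) (at t)" if "t \<in> {0..1} - S" for t
    using vector_derivative_diff_chain_within[OF S(2)[OF that]
        has_derivative_at_withinI[OF has_derivative_torus_map]]
    unfolding D'_def by blast
  have D'_eq: "D' = (\<lambda>t. \<chi> j. D t $ j *\<^sub>R (\<i> * cis (\<gamma> t $ j)))"
    unfolding D'_def torus_frame_def axis_def torus_map_def
    by (simp add: fun_eq_iff vec_eq_iff if_distrib if_distribR cong: if_cong)
  have "continuous_on ({0..1} - S) \<gamma>"
    using S(4) by (rule continuous_on_subset) auto
  then have "continuous_on ({0..1} - S) D'"
    unfolding D'_eq using S(3) by (intro continuous_on_vec_lambda) (intro continuous_intros)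
  moreover have "continuous_on {0..1} (torus_map \<circ> \<gamma>)"
    by (rule continuous_on_compose[OF S(4) continuous_on_torus_map])
  ultimately have "valid_path (torus_map \<circ> \<gamma>)"
    unfolding valid_path_def piecewise_C1_differentiable_on_def C1_differentiable_on_def
    using S(1) D' by blast
  then show "torus_curve (torus_map \<circ> \<gamma>)"
    by (auto simp: torus_curve_def path_image_def)
  show "curve_length g (torus_map \<circ> \<gamma>) = lifted_length (lifted_metric g) \<gamma>"
    unfolding curve_length_def lifted_length_def
  proof (rule nn_integral_cong_AE)
    show "AE t in lborel. ennreal (sqrt (g ((torus_map \<circ> \<gamma>) t)
          (vector_derivative (torus_map \<circ> \<gamma>) (at t)) (vector_derivative (torus_map \<circ> \<gamma>) (at t)))) *
          indicator {0..1} t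
        = ennreal (speed (lifted_metric g) (\<gamma> t) (vector_derivative \<gamma> (at t))) * indicator {0..1} t"
      using finite_AE_lborel[OF S(1)]
    proof eventually_elim
      case (elim t)
      show ?case
      proof (cases "t \<in> {0..1}")
        case True
        with elim have "t \<in> {0..1} - S" by simp
        then have "vector_derivative (torus_map \<circ> \<gamma>) (at t) = D' t" "vector_derivative \<gamma> (at t) = D t"
          using vector_derivative_at[OF D'] vector_derivative_at[OF S(2)] by blast+
        then show ?thesis
          by (simp add: D'_def metric_on_frame_combinations speed_def lifted_metric_def)
      qed simp
    qed
  qed
qed

lemma near_imp_in_riemannian_ball:
  assumes "near (lifted_metric g) r x y"
  shows "torus_map y \<in> riemannian_ball g (torus_map x) r"
proof -
  obtain \<gamma> where \<gamma>: "valid_path \<gamma>" "pathstart \<gamma> = x" "pathfinish \<gamma> = y"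
    "lifted_length (lifted_metric g) \<gamma> < ennreal r"
    using assms unfolding near_def by blast
  have "riemannian_dist g (torus_map x) (torus_map y) \<le> curve_length g (torus_map \<circ> \<gamma>)"
    unfolding riemannian_dist_def using projected_curve(1)[OF \<gamma>(1)] \<gamma>(2,3)
    by (intro Inf_lower CollectI exI[of _ "torus_map \<circ> \<gamma>"]) (auto simp: pathstart_compose pathfinish_compose)
  also have "\<dots> < ennreal r" using \<gamma>(4) projected_curve(2)[OF \<gamma>(1)] by simp
  finally show ?thesis by (simp add: riemannian_ball_def)
qed

text \<open>
  A path in \<open>\<real>\<^sup>n\<close> from \<open>x\<close> to \<open>x + lat m\<close> projects to a loop whose \<open>i\<close>-th coordinate has winding
  number \<open>m $ i\<close> around the origin, which is a homotopy invariant.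
\<close>

lemma not_contractible_projection:
  fixes \<gamma> :: "real \<Rightarrow> real ^ 'n"
  assumes "path \<gamma>" "pathfinish \<gamma> = pathstart \<gamma> + lat m" "m \<noteq> 0"
  shows "\<not> contractible_loop (torus_map \<circ> \<gamma>)"
proof
  assume "contractible_loop (torus_map \<circ> \<gamma>)"
  then obtain a where a: "homotopic_loops torus (torus_map \<circ> \<gamma>) (linepath a a)"
    by (auto simp: contractible_loop_def)
  obtain i where i: "m $ i \<noteq> 0" using assms(3) by (auto simp: vec_eq_iff)
  let ?pr = "\<lambda>z::complex ^ 'n. z $ i"
  have "homotopic_loops (- {0}) (?pr \<circ> (torus_map \<circ> \<gamma>)) (?pr \<circ> linepath a a)"
  proof (rule homotopic_loops_continuous_image[OF a])
    show "continuous_on torus ?pr" by (intro continuous_intros)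
    show "?pr \<in> torus \<rightarrow> - {0}" by (auto simp: torus_def dest!: spec[of _ i])
  qed
  then have eq: "winding_number (?pr \<circ> (torus_map \<circ> \<gamma>)) 0 = winding_number (?pr \<circ> linepath a a) 0"
    by (rule winding_number_homotopic_loops)
  have "a \<in> torus" using homotopic_loops_imp_subset[OF a] by (auto simp: path_image_def linepath_def)
  then have "a $ i \<noteq> 0" by (auto simp: torus_def dest!: spec[of _ i])
  moreover have "?pr \<circ> linepath a a = linepath (a $ i) (a $ i)" by (auto simp: linepath_def scaleR_left_distrib[symmetric])
  ultimately have 0: "winding_number (?pr \<circ> linepath a a) 0 = 0" by simp
  let ?p = "\<lambda>t. \<i> * complex_of_real (\<gamma> t $ i)"
  have "?pr \<circ> (torus_map \<circ> \<gamma>) = exp \<circ> ?p"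
    by (auto simp: torus_map_def cis_conv_exp)
  moreover have "path ?p" using assms(1) unfolding path_def by (intro continuous_intros)
  ultimately have "winding_number (?pr \<circ> (torus_map \<circ> \<gamma>)) 0
      = (pathfinish ?p - pathstart ?p) / (2 * of_real pi * \<i>)"
    using winding_number_compose_exp by metis
  also have "pathfinish ?p - pathstart ?p = \<i> * complex_of_real (2 * pi * of_int (m $ i))"
    using assms(2) by (simp add: pathfinish_def pathstart_def lat_def algebra_simps)
  also have "\<dots> / (2 * of_real pi * \<i>) = of_int (m $ i)" by simp
  finally have "complex_of_int (m $ i) = 0" using eq 0 by argo
  then show False using i by simp
qed

text \<open>
  Different lifts of a point of the torus are at distance at least the systole.
\<close>

lemma near_lat_systole:
  assumes "near (lifted_metric g) r x (x + lat m)" "ennreal r \<le> systole g"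
  shows "m = 0"
proof (rule ccontr)
  assume "m \<noteq> 0"
  obtain \<gamma> where \<gamma>: "valid_path \<gamma>" "pathstart \<gamma> = x" "pathfinish \<gamma> = x + lat m"
    "lifted_length (lifted_metric g) \<gamma> < ennreal r"
    using assms unfolding near_def by blast
  have "systole g \<le> curve_length g (torus_map \<circ> \<gamma>)"
    unfolding systole_def using projected_curve(1)[OF \<gamma>(1)] \<gamma>(2,3)
      not_contractible_projection[OF valid_path_imp_path[OF \<gamma>(1)], of m] \<open>m \<noteq> 0\<close>
    by (intro Inf_lower CollectI exI[of _ "torus_map \<circ> \<gamma>"]) (auto simp: pathstart_compose pathfinish_compose)
  also have "\<dots> < ennreal r" using \<gamma>(4) projected_curve(2)[OF \<gamma>(1)] by simp
  finally show False using assms(2) by simp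
qed

end

section \<open>Volumes of ellipsoids\<close>

text \<open>
  The change of volume under a linear map, with no order on the index type. It is checked on
  elementary maps, where only coordinate swaps and shears need an argument.
\<close>

lemma linear_image_measure:
  fixes f :: "real ^ 'n::finite \<Rightarrow> real ^ 'n"
  assumes "linear f" "S \<in> lmeasurable"
  shows "f ` S \<in> lmeasurable \<and> measure lebesgue (f ` S) = \<bar>det (matrix f)\<bar> * measure lebesgue S"
proof -
  define Q where "Q h \<longleftrightarrow> (\<forall>S\<in>lmeasurable. h ` S \<in> lmeasurable \<and>
      measure lebesgue (h ` S) = \<bar>det (matrix h)\<bar> * measure lebesgue S)" for h :: "real ^ 'n \<Rightarrow> real ^ 'n"
  have QI: "Q h" if "linear h" "\<bar>det (matrix h)\<bar> = 1"
    "\<And>a b. cbox a b \<noteq> {} \<Longrightarrow> measure lebesgue (h ` cbox a b) = measure lebesgue (cbox a b)" for h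
  proof -
    have box: "measure lebesgue (h ` cbox a b) = 1 * measure lebesgue (cbox a b)" for a b
      using that(3)[of a b] by (cases "cbox a b = {}") simp_all
    show ?thesis
      unfolding Q_def
    proof
      fix S :: "(real ^ 'n) set" assume "S \<in> lmeasurable"
      from measure_linear_sufficient[OF that(1) this box]
      show "h ` S \<in> lmeasurable \<and> measure lebesgue (h ` S) = \<bar>det (matrix h)\<bar> * measure lebesgue S"
        using that(2) by simp
    qed
  qed
  have "Q f"
  proof (rule induct_linear_elementary[OF assms(1)])
    fix g h :: "real ^ 'n \<Rightarrow> real ^ 'n" assume gh: "linear g" "linear h" "Q g" "Q h"
    show "Q (g \<circ> h)"
      unfolding Q_def
    proof
      fix S :: "(real ^ 'n) set" assume "S \<in> lmeasurable"
      then have "h ` S \<in> lmeasurable" "measure lebesgue (h ` S) = \<bar>det (matrix h)\<bar> * measure lebesgue S"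
        using gh(4) unfolding Q_def by blast+
      moreover from this have "g ` h ` S \<in> lmeasurable"
          "measure lebesgue (g ` h ` S) = \<bar>det (matrix g)\<bar> * measure lebesgue (h ` S)"
        using gh(3) unfolding Q_def by blast+
      ultimately show "(g \<circ> h) ` S \<in> lmeasurable \<and>
          measure lebesgue ((g \<circ> h) ` S) = \<bar>det (matrix (g \<circ> h))\<bar> * measure lebesgue S"
        using matrix_compose[OF gh(2,1)] by (simp add: image_comp det_mul abs_mult)
    qed
  next
    fix h :: "real ^ 'n \<Rightarrow> real ^ 'n" and i assume h: "linear h" "\<And>x. h x $ i = 0"
    have "\<not> inj h"
    proof
      assume "inj h"
      then obtain x where "h x = axis i 1" using linear_injective_imp_surjective[OF h(1)] by (metis surjD)
      then show False using h(2)[of x] by simp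
    qed
    moreover from this have "det (matrix h) = 0" using det_nz_iff_inj[OF h(1)] by blast
    ultimately show "Q h"
      unfolding Q_def using negligible_linear_singular_image[OF h(1)]
      by (auto simp: negligible_imp_measure0 negligible_iff_measure)
  next
    show "Q (\<lambda>x. \<chi> i. c i * x $ i)" for c
      unfolding Q_def by (simp add: measurable_stretch measure_stretch matrix_def det_diagonal axis_def)
  next
    fix m n :: 'n assume "m \<noteq> n"
    let ?p = "Transposition.transpose m n"
    let ?h = "\<lambda>x :: real ^ 'n. \<chi> i. x $ ?p i"
    show "Q ?h"
    proof (rule QI)
      show "linear ?h" by (intro linearI) (simp_all add: vec_eq_iff)
      have "matrix ?h = (\<chi> i. (mat 1 :: real ^ 'n ^ 'n) $ ?p i)"
        by (simp add: matrix_def mat_def axis_def vec_eq_iff)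
      then show "\<bar>det (matrix ?h)\<bar> = 1"
        by (simp add: det_permute_rows permutes_swap_id sign_swap_id abs_mult)
      fix a b :: "real ^ 'n" assume ab: "cbox a b \<noteq> {}"
      have mem: "?h x \<in> cbox (?h a) (?h b) \<longleftrightarrow> x \<in> cbox a b" for x
        by (simp add: mem_box_cart) (metis transpose_involutory)
      have hh: "?h (?h x) = x" for x by (simp add: vec_eq_iff)
      have eq: "?h ` cbox a b = cbox (?h a) (?h b)"
      proof (intro equalityI subsetI)
        fix y assume "y \<in> cbox (?h a) (?h b)"
        then have "?h y \<in> cbox a b" using mem[of "?h y"] unfolding hh by blast
        then have "?h (?h y) \<in> ?h ` cbox a b" by (rule imageI)
        then show "y \<in> ?h ` cbox a b" unfolding hh .
      qed (use mem in blast)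
      then have "cbox (?h a) (?h b) \<noteq> {}" using ab by blast
      then have "measure lebesgue (?h ` cbox a b) = (\<Prod>i\<in>UNIV. b $ ?p i - a $ ?p i)"
        unfolding eq by (simp add: content_cbox_cart)
      also have "\<dots> = (\<Prod>i\<in>UNIV. b $ i - a $ i)"
        using prod.permute[OF permutes_swap_id, of m UNIV n "\<lambda>i. b $ i - a $ i"] by (simp add: o_def)
      finally show "measure lebesgue (?h ` cbox a b) = measure lebesgue (cbox a b)"
        using ab by (simp add: content_cbox_cart)
    qed
  next
    fix m n :: 'n assume mn: "m \<noteq> n"
    let ?h = "\<lambda>x :: real ^ 'n. \<chi> i. if i = m then x $ m + x $ n else x $ i"
    show "Q ?h"
    proof (rule QI)
      show lin: "linear ?h" by (intro linearI) (simp_all add: vec_eq_iff algebra_simps)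
      have "matrix ?h = (\<chi> k. if k = m then row m (mat 1) + 1 *s row n (mat 1) else row k (mat 1))"
        by (auto simp: matrix_def mat_def row_def axis_def vec_eq_iff)
      then show "\<bar>det (matrix ?h)\<bar> = 1"
        using det_row_operation[OF mn, of "mat 1" "1 :: real"] by simp
      fix a b :: "real ^ 'n" assume ab: "cbox a b \<noteq> {}"
      \<comment> \<open>Translate the box so that its lower end in direction \<open>n\<close> is \<open>0\<close>.\<close>
      let ?v = "axis n (- a $ n)"
      have ne: "cbox (?v + a) (?v + b) \<noteq> {}" using ab unfolding cbox_translation by blast
      have "?h ` cbox (?v + a) (?v + b) = (+) (?h ?v) ` ?h ` cbox a b"
        unfolding cbox_translation image_image linear_add[OF lin] ..
      then have "measure lebesgue (?h ` cbox a b) = measure lebesgue (?h ` cbox (?v + a) (?v + b))"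
        by (simp add: measure_translation)
      also have "\<dots> = measure lebesgue (cbox (?v + a) (?v + b))"
        by (rule measure_shear_interval[OF mn ne]) simp
      also have "\<dots> = measure lebesgue (cbox a b)"
        unfolding cbox_translation by (rule measure_translation)
      finally show "measure lebesgue (?h ` cbox a b) = measure lebesgue (cbox a b)" .
    qed
  qed
  then show ?thesis using assms(2) by (simp add: Q_def)
qed

text \<open>
  Orthonormal families for the inner product given by \<open>A\<close>, one vector at a time: a vector that is
  orthogonal in the ordinary sense to the vectors \<open>A *v b j\<close> is \<open>A\<close>-orthogonal to the \<open>b j\<close>.
\<close>

lemma exists_orthonormal_family:
  fixes A :: "real ^ 'n::finite ^ 'n"
  assumes sym: "transpose A = A" and pos: "\<And>u. u \<noteq> 0 \<Longrightarrow> u \<bullet> (A *v u) > 0"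
  shows "k \<le> CARD('n) \<Longrightarrow>
    \<exists>b :: nat \<Rightarrow> real ^ 'n. \<forall>i<k. \<forall>j<k. b i \<bullet> (A *v b j) = (if i = j then 1 else 0)"
proof (induction k)
  case (Suc k)
  have A_sym: "u \<bullet> (A *v w) = w \<bullet> (A *v u)" for u w
    using dot_lmul_matrix[of w A u] vector_transpose_matrix[of w A] sym by (simp add: inner_commute)
  obtain b :: "nat \<Rightarrow> real ^ 'n" where b: "\<And>i j. i < k \<Longrightarrow> j < k \<Longrightarrow> b i \<bullet> (A *v b j) = (if i = j then 1 else 0)"
    using Suc by auto
  have "dim ((\<lambda>j. A *v b j) ` {..<k}) \<le> card ((\<lambda>j. A *v b j) ` {..<k})"
    by (rule dim_le_card') simp
  also have "\<dots> \<le> k" using card_image_le[of "{..<k}"] by simp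
  also have "k < DIM(real ^ 'n)" using Suc.prems by simp
  finally obtain x where x: "x \<noteq> 0" "\<And>y. y \<in> span ((\<lambda>j. A *v b j) ` {..<k}) \<Longrightarrow> orthogonal x y"
    by (rule orthogonal_to_subspace_exists) blast
  have x0: "x \<bullet> (A *v b j) = 0" if "j < k" for j
    using x(2)[of "A *v b j"] that by (auto simp: orthogonal_def intro: span_base)
  define c where "c = sqrt (x \<bullet> (A *v x))"
  have "c > 0" "c * c = x \<bullet> (A *v x)" using pos[OF x(1)] by (simp_all add: c_def)
  define b' where "b' = b(k := inverse c *\<^sub>R x)"
  have b'_less: "b' i = b i" if "i < k" for i using that by (simp add: b'_def)
  have b'_k: "b' k = inverse c *\<^sub>R x" by (simp add: b'_def)
  have off: "b' k \<bullet> (A *v b' j) = 0" if "j < k" for j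
    using that by (simp add: b'_less b'_k x0)
  moreover have "b' i \<bullet> (A *v b' k) = 0" if "i < k" for i
    using off[OF that] by (simp only: A_sym[of "b' i"])
  moreover have "b' k \<bullet> (A *v b' k) = 1"
  proof -
    have "b' k \<bullet> (A *v b' k) = inverse c * inverse c * (x \<bullet> (A *v x))"
      by (simp add: b'_k matrix_vector_mult_scaleR)
    also have "\<dots> = 1"
      unfolding \<open>c * c = x \<bullet> (A *v x)\<close>[symmetric] using \<open>c > 0\<close> by (simp add: field_simps)
    finally show ?thesis .
  qed
  moreover have "b' i \<bullet> (A *v b' j) = (if i = j then 1 else 0)" if "i < k" "j < k" for i j
    using b[OF that] that by (simp add: b'_less)
  ultimately have "\<forall>i<Suc k. \<forall>j<Suc k. b' i \<bullet> (A *v b' j) = (if i = j then 1 else 0)"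
    by (simp add: less_Suc_eq all_conj_distrib disj_imp) (metis less_irrefl)
  then show ?case by blast
qed simp

lemma exists_congruence_to_identity:
  fixes A :: "real ^ 'n::finite ^ 'n"
  assumes sym: "transpose A = A" and pos: "\<And>u. u \<noteq> 0 \<Longrightarrow> u \<bullet> (A *v u) > 0"
  obtains P :: "real ^ 'n ^ 'n" where "transpose P ** A ** P = mat 1"
proof -
  obtain b :: "nat \<Rightarrow> real ^ 'n" where b: "\<And>i j. i < CARD('n) \<Longrightarrow> j < CARD('n) \<Longrightarrow> b i \<bullet> (A *v b j) = (if i = j then 1 else 0)"
    using exists_orthonormal_family[OF assms, of "CARD('n)"] by auto
  obtain e :: "'n \<Rightarrow> nat" where e: "bij_betw e UNIV {0..<CARD('n)}"
    using ex_bij_betw_finite_nat[of "UNIV :: 'n set"] by auto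
  have e_less: "e i < CARD('n)" for i using bij_betwE[OF e] by auto
  have e_eq: "e i = e j \<longleftrightarrow> i = j" for i j using bij_betw_imp_inj_on[OF e] by (auto simp: inj_on_def)
  define P :: "real ^ 'n ^ 'n" where "P = (\<chi> i j. b (e j) $ i)"
  have col: "column j P = b (e j)" for j by (simp add: P_def column_def vec_eq_iff)
  have "(transpose P ** A ** P) $ i $ j = b (e i) \<bullet> (A *v b (e j))" for i j
    unfolding matrix_mul_assoc[symmetric] col[symmetric]
    by (simp add: matrix_matrix_mult_def matrix_vector_mult_def transpose_def column_def inner_vec_def)
  then have "transpose P ** A ** P = mat 1"
    by (simp add: vec_eq_iff mat_def b e_less e_eq)
  then show ?thesis by (rule that)
qed

lemma det_positive_definite:
  fixes A :: "real ^ 'n::finite ^ 'n"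
  assumes sym: "transpose A = A" and pos: "\<And>u. u \<noteq> 0 \<Longrightarrow> u \<bullet> (A *v u) > 0"
  shows "det A > 0"
proof -
  obtain P :: "real ^ 'n ^ 'n" where "transpose P ** A ** P = mat 1"
    using exists_congruence_to_identity[OF assms] by blast
  then have "det P * det A * det P = 1" by (metis det_mul det_transpose det_I)
  then have "(det P)\<^sup>2 * det A = 1" by (simp add: power2_eq_square mult_ac)
  then show ?thesis by (metis zero_less_one zero_less_mult_iff not_less zero_le_power2)
qed

text \<open>
  Measured with the density \<open>sqrt (det A)\<close> of the inner product \<open>A\<close>, its ball of radius \<open>\<rho>\<close> has
  the same volume as a Euclidean ball of radius \<open>\<rho>\<close>.
\<close>

lemma ellipsoid_volume:
  fixes A :: "real ^ 'n::finite ^ 'n" and v :: "real ^ 'n"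
  assumes sym: "transpose A = A" and pos: "\<And>u. u \<noteq> 0 \<Longrightarrow> u \<bullet> (A *v u) > 0" and "\<rho> > 0"
  defines "E \<equiv> {y. sqrt ((y - v) \<bullet> (A *v (y - v))) < \<rho>}"
  shows "E \<in> lmeasurable" "sqrt (det A) * measure lebesgue E = \<rho> ^ CARD('n) * measure lebesgue (ball (0 :: real ^ 'n) 1)"
proof -
  obtain P :: "real ^ 'n ^ 'n" where P: "transpose P ** A ** P = mat 1"
    using exists_congruence_to_identity[OF sym pos] by blast
  have "det P * det A * det P = 1" using P by (metis det_mul det_transpose det_I)
  then have detP: "(det P)\<^sup>2 * det A = 1" by (simp add: power2_eq_square mult_ac)
  then have "det P \<noteq> 0" by auto
  then obtain P' where P': "P ** P' = mat 1" using invertible_det_nz[of P] unfolding invertible_def by blast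
  have "sqrt ((det P)\<^sup>2 * det A) = 1" using detP by simp
  then have sq: "sqrt (det A) * \<bar>det P\<bar> = 1" by (simp add: real_sqrt_mult mult.commute)
  have form: "(P *v w) \<bullet> (A *v (P *v w)) = w \<bullet> w" for w
  proof -
    have "(P *v w) \<bullet> (A *v (P *v w)) = w \<bullet> (transpose P *v (A *v (P *v w)))"
      using dot_lmul_matrix[of w "transpose P" "A *v (P *v w)"] by (simp add: vector_transpose_matrix)
    also have "\<dots> = w \<bullet> ((transpose P ** A ** P) *v w)" by (simp add: matrix_vector_mul_assoc matrix_mul_assoc)
    finally show ?thesis by (simp add: P)
  qed
  have "E = (+) v ` (\<lambda>w. P *v w) ` ball 0 \<rho>"
  proof (intro set_eqI iffI)
    fix y assume "y \<in> E"
    let ?w = "P' *v (y - v)"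
    have Pw: "P *v ?w = y - v" by (simp add: matrix_vector_mul_assoc P')
    then have "sqrt (?w \<bullet> ?w) < \<rho>" using \<open>y \<in> E\<close> form[of ?w] by (simp add: E_def)
    then have "?w \<in> ball 0 \<rho>" by (simp add: norm_eq_sqrt_inner)
    moreover have "y = v + P *v ?w" using Pw by simp
    ultimately show "y \<in> (+) v ` (\<lambda>w. P *v w) ` ball 0 \<rho>" by blast
  qed (auto simp: E_def form norm_eq_sqrt_inner)
  moreover note img = linear_image_measure[OF matrix_vector_mul_linear[of P], of "ball 0 \<rho>"]
  ultimately show "E \<in> lmeasurable" by (simp add: measurable_translation)
  have "measure lebesgue E = \<bar>det P\<bar> * measure lebesgue (ball (0 :: real ^ 'n) \<rho>)"
    using \<open>E = _\<close> img by (simp add: measure_translation)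
  also have "measure lebesgue (ball (0 :: real ^ 'n) \<rho>) = \<rho> ^ CARD('n) * measure lebesgue (ball (0 :: real ^ 'n) 1)"
    using content_ball_conv_unit_ball[of \<rho> "0 :: real ^ 'n"] \<open>\<rho> > 0\<close> by simp
  finally show "sqrt (det A) * measure lebesgue E = \<rho> ^ CARD('n) * measure lebesgue (ball (0 :: real ^ 'n) 1)"
    using sq by (simp add: mult.assoc[symmetric])
qed

section \<open>The fundamental domain\<close>

text \<open>
  The half-open box of angles, a fundamental domain for the translations by \<open>lat m\<close>.
\<close>

definition fundamental_box :: "(real ^ 'n) set" where
  "fundamental_box = {x. \<forall>i. 0 \<le> x $ i \<and> x $ i < 2 * pi}"

text \<open>
  \<open>cell x\<close> is the \<open>m\<close> for which \<open>x\<close> lies in the fundamental box translated by \<open>lat m\<close>.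
\<close>

definition cell :: "real ^ 'n \<Rightarrow> int ^ 'n" where
  "cell x = (\<chi> i. \<lfloor>x $ i / (2 * pi)\<rfloor>)"

lemma cell_bounds: fixes x :: "real ^ 'n" shows "of_int (cell x $ i) \<le> x $ i / (2 * pi)" "x $ i / (2 * pi) < of_int (cell x $ i) + 1"
  by (simp_all add: cell_def)

lemma diff_lat_cell_in_fundamental_box: "x - lat (cell x) \<in> fundamental_box"
  using cell_bounds[of x] by (auto simp: fundamental_box_def lat_def field_simps)

lemma two_pi_pos: "0 < 2 * pi" by simp

lemma fundamental_box_unique:
  assumes "x \<in> fundamental_box" "x + lat m \<in> fundamental_box"
  shows "m = 0"
proof -
  have "m $ i = 0" for i
  proof -
    have "0 \<le> x $ i" "x $ i < 2 * pi" "0 \<le> x $ i + 2 * pi * of_int (m $ i)" "x $ i + 2 * pi * of_int (m $ i) < 2 * pi"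
      using assms by (auto simp: fundamental_box_def lat_def)
    then have "2 * pi * (-1) < 2 * pi * of_int (m $ i)" "2 * pi * of_int (m $ i) < 2 * pi * 1" by linarith+
    then have "(-1::real) < of_int (m $ i)" "of_int (m $ i) < (1::real)"
      by (auto simp only: mult_less_cancel_left_pos[OF two_pi_pos])
    then show ?thesis by linarith
  qed
  then show ?thesis by (simp add: vec_eq_iff)
qed

lemma cell_eqI: "x - lat m \<in> fundamental_box \<Longrightarrow> cell x = m"
  using fundamental_box_unique[of "x - lat m" "m - cell x"] diff_lat_cell_in_fundamental_box[of x]
  by (simp add: algebra_simps)

lemma fundamental_box_subset_cbox: "fundamental_box \<subseteq> cbox 0 (\<chi> i. 2 * pi)"
  by (auto simp: fundamental_box_def mem_box_cart less_imp_le)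

lemma measurable_fundamental_box [measurable]: "fundamental_box \<in> sets borel"
proof -
  have "fundamental_box = (\<Inter>i. {x. 0 \<le> x $ i} \<inter> {x. x $ i < 2 * pi})"
    by (auto simp: fundamental_box_def)
  also have "\<dots> \<in> sets borel"
    by (intro sets.countable_INT'' sets.Int borel_closed borel_open
        closed_Collect_le open_Collect_less continuous_intros) auto
  finally show ?thesis .
qed

lemma finite_cells:
  assumes "bounded W"
  shows "finite (cell ` W)"
proof -
  obtain b where b: "\<And>x. x \<in> W \<Longrightarrow> norm x \<le> b" using assms by (auto simp: bounded_iff)
  define N where "N = \<lceil>b\<rceil> + 1"
  have "cell ` W \<subseteq> (\<lambda>f. \<chi> i. f i) ` (UNIV \<rightarrow>\<^sub>E {- N..N})"
  proof
    fix m assume "m \<in> cell ` W"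
    then obtain x where x: "x \<in> W" "m = cell x" by blast
    have "- N \<le> m $ i \<and> m $ i \<le> N" for i
    proof -
      have "\<bar>x $ i\<bar> \<le> b" using b[OF x(1)] component_le_norm_cart[of x i] by linarith
      moreover have "\<bar>x $ i / (2 * pi)\<bar> \<le> \<bar>x $ i\<bar>"
        using pi_ge_two divide_left_mono[of 1 "2 * pi" "\<bar>x $ i\<bar>"] by (simp add: abs_divide)
      ultimately have "\<bar>x $ i / (2 * pi)\<bar> \<le> b" by linarith
      then have "of_int (m $ i) \<le> b" "- b < of_int (m $ i) + 1"
        unfolding x(2) using cell_bounds[where x = x and i = i] by linarith+
      then show ?thesis unfolding N_def by linarith
    qed
    then show "m \<in> (\<lambda>f. \<chi> i. f i) ` (UNIV \<rightarrow>\<^sub>E {- N..N})"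
      by (intro image_eqI[of _ _ "\<lambda>i. m $ i"]) auto
  qed
  moreover have "finite ((UNIV :: 'a set) \<rightarrow>\<^sub>E {- N..N})" by (intro finite_PiE) auto
  ultimately show ?thesis by (meson finite_imageI finite_subset)
qed

lemma nn_integral_translate:
  fixes f :: "'a::euclidean_space \<Rightarrow> ennreal"
  assumes [measurable]: "f \<in> borel_measurable borel"
  shows "(\<integral>\<^sup>+x. f (x + c) \<partial>lborel) = (\<integral>\<^sup>+x. f x \<partial>lborel)"
  by (subst (2) lborel_distr_plus[symmetric, of c]) (simp add: nn_integral_distr add.commute)

text \<open>
  A set that contains at most one point of each orbit can be moved piecewise into the fundamental
  box without overlaps.
\<close>

lemma nn_integral_le_fundamental_box:
  fixes F :: "real ^ 'n::finite \<Rightarrow> ennreal"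
  assumes [measurable]: "F \<in> borel_measurable borel" "W \<in> sets borel"
    and "bounded W" and per: "\<And>x m. F (x + lat m) = F x"
    and inj: "\<And>x m. x \<in> W \<Longrightarrow> x + lat m \<in> W \<Longrightarrow> m = 0"
  shows "(\<integral>\<^sup>+x\<in>W. F x \<partial>lborel) \<le> (\<integral>\<^sup>+x\<in>{x \<in> fundamental_box. \<exists>m. x + lat m \<in> W}. F x \<partial>lborel)"
proof -
  let ?M = "cell ` W" and ?D = "{x \<in> fundamental_box. \<exists>m. x + lat m \<in> W}"
  have fin: "finite ?M" using finite_cells[OF \<open>bounded W\<close>] .
  \<comment> \<open>The contribution of the part of \<open>W\<close> in the translate by \<open>lat m\<close>, moved into the box.\<close>
  define h where "h m x = F x * indicator W (x + lat m) * indicator fundamental_box x" for m x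
  have h_meas [measurable]: "h m \<in> borel_measurable borel" for m unfolding h_def by measurable
  have "(\<integral>\<^sup>+x\<in>W. F x \<partial>lborel) = (\<integral>\<^sup>+x. (\<Sum>m\<in>?M. h m (x + lat (- m))) \<partial>lborel)"
  proof (rule nn_integral_cong)
    fix x :: "real ^ 'n"
    have "x + lat (- m) \<in> fundamental_box \<longleftrightarrow> m = cell x" for m
      using cell_eqI[of x m] diff_lat_cell_in_fundamental_box[of x] by auto
    then have "indicator fundamental_box (x + lat (- m)) = (indicator {cell x} m :: ennreal)" for m
      by (simp add: indicator_def)
    then have "h m (x + lat (- m)) = F x * (indicator W x * indicator {cell x} m)" for m
      unfolding h_def per by (simp add: mult.assoc)
    then have "(\<Sum>m\<in>?M. h m (x + lat (- m))) = F x * (\<Sum>m\<in>?M. indicator W x * indicator {cell x} m)"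
      by (simp add: sum_distrib_left)
    also have "(\<Sum>m\<in>?M. indicator W x * indicator {cell x} m) = (indicator W x :: ennreal)"
      using fin by (cases "x \<in> W") (auto simp: indicator_def sum.delta)
    finally show "F x * indicator W x = (\<Sum>m\<in>?M. h m (x + lat (- m)))" by simp
  qed
  also have "\<dots> = (\<Sum>m\<in>?M. \<integral>\<^sup>+x. h m (x + lat (- m)) \<partial>lborel)"
    by (rule nn_integral_sum) measurable
  also have "\<dots> = (\<Sum>m\<in>?M. \<integral>\<^sup>+x. h m x \<partial>lborel)"
    by (intro sum.cong refl nn_integral_translate) measurable
  also have "\<dots> = (\<integral>\<^sup>+x. (\<Sum>m\<in>?M. h m x) \<partial>lborel)"
    by (rule nn_integral_sum[symmetric]) measurable
  also have "\<dots> \<le> (\<integral>\<^sup>+x\<in>?D. F x \<partial>lborel)"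
  proof (rule nn_integral_mono)
    fix x :: "real ^ 'n"
    show "(\<Sum>m\<in>?M. h m x) \<le> F x * indicator ?D x"
    proof (cases "\<exists>m0\<in>?M. h m0 x \<noteq> 0")
      case True
      then obtain m0 where m0: "m0 \<in> ?M" "h m0 x \<noteq> 0" by blast
      then have x: "x + lat m0 \<in> W" "x \<in> fundamental_box"
        by (auto simp: h_def split: split_indicator_asm)
      have "h m x = 0" if "m \<noteq> m0" for m
        using inj[OF x(1), of "m - m0"] that by (auto simp: h_def algebra_simps split: split_indicator)
      then have "(\<Sum>m\<in>?M. h m x) = h m0 x"
        using fin m0(1) sum.mono_neutral_right[of ?M "{m0}" "\<lambda>m. h m x"] by simp
      also have "\<dots> = F x * indicator ?D x"
      proof -
        have "x \<in> ?D" using x by blast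
        then show ?thesis using x by (simp add: h_def)
      qed
      finally show ?thesis by simp
    next
      case False
      then have "(\<Sum>m\<in>?M. h m x) = 0" by (intro sum.neutral) blast
      then show ?thesis by simp
    qed
  qed
  finally show ?thesis .
qed

section \<open>Comparison with constant metrics\<close>

context periodic_metric
begin

lemma periodic_diff [simp]: "G (x - lat m) = G x"
  using periodic[of "x - lat m" m] by simp

lemma speed_bounds:
  obtains \<mu> \<nu> where "\<mu> > 0" "\<nu> > 0" "\<And>x u. \<mu> * norm u \<le> speed G x u" "\<And>x u. speed G x u \<le> \<nu> * norm u"
proof -
  let ?B = "cbox 0 (\<chi> i. 2 * pi) :: (real ^ 'n) set"
  let ?K = "?B \<times> sphere (0 :: real ^ 'n) 1"
  let ?f = "\<lambda>(x, u). speed G x u"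
  have "compact ?K" by (intro compact_Times compact_cbox compact_sphere)
  have "0 \<in> ?B" by (simp add: mem_box_cart)
  moreover obtain e :: "real ^ 'n" where "norm e = 1" using vector_choose_size[of 1] by auto
  ultimately have "(0, e) \<in> ?K" by simp
  then have "?K \<noteq> {}" by blast
  have "continuous_on ?K (\<lambda>p. speed G (fst p) (snd p))"
    by (intro continuous_speed continuous_intros)
  then have cf: "continuous_on ?K ?f" by (simp add: case_prod_unfold)
  obtain p where p: "p \<in> ?K" "\<And>q. q \<in> ?K \<Longrightarrow> ?f p \<le> ?f q"
    using continuous_attains_inf[OF \<open>compact ?K\<close> \<open>?K \<noteq> {}\<close> cf] by blast
  obtain p' where p': "p' \<in> ?K" "\<And>q. q \<in> ?K \<Longrightarrow> ?f q \<le> ?f p'"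
    using continuous_attains_sup[OF \<open>compact ?K\<close> \<open>?K \<noteq> {}\<close> cf] by blast
  have pos': "speed G x u > 0" if "norm u = 1" for x u
    using pos[of u x] that norm_zero by (fastforce simp: speed_def)
  have unit: "?f p \<le> speed G x u \<and> speed G x u \<le> ?f p'" if "norm u = 1" for x u
  proof -
    have "x - lat (cell x) \<in> ?B"
      using diff_lat_cell_in_fundamental_box fundamental_box_subset_cbox by blast
    then have "(x - lat (cell x), u) \<in> ?K" using that by simp
    from p(2)[OF this] p'(2)[OF this] show ?thesis by (simp add: speed_def)
  qed
  have bounds: "?f p * norm u \<le> speed G x u \<and> speed G x u \<le> ?f p' * norm u" for x u
  proof (cases "u = 0")
    case False
    have "speed G x u = norm u * speed G x (inverse (norm u) *\<^sub>R u)"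
      using False by (simp add: speed_scaleR)
    moreover have "norm (inverse (norm u) *\<^sub>R u) = 1" using False by simp
    ultimately show ?thesis using unit[of "inverse (norm u) *\<^sub>R u" x] by (simp add: mult.commute mult_left_mono)
  qed (simp add: speed_def)
  show ?thesis
    by (rule that[of "?f p" "?f p'"]) (use p(1) p'(1) pos' bounds in auto)
qed

lemma continuous_det: "continuous_on A (\<lambda>x. det (G x))"
  unfolding det_def using continuous_on_subset[OF cont] by (intro continuous_intros) auto

lemma det_pos: "det (G x) > 0"
  by (rule det_positive_definite[OF sym pos])

text \<open>
  At nearby points the metrics differ by a bounded factor, and so do the volume densities. The
  number \<open>\<eta>\<close> does not depend on the point, by compactness.
\<close>

lemma local_comparison:
  obtains \<eta> where "\<eta> > 0" "\<And>x y u. dist x y < \<eta> \<Longrightarrow> speed G y u \<le> 2 * speed G x u"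
    "\<And>x y. dist x y < \<eta> \<Longrightarrow> det (G x) / 4 \<le> det (G y)"
proof -
  define C :: "(real ^ 'n) set" where "C = cbox (\<chi> i. -1) (\<chi> i. 2 * pi + 1)"
  have "compact C" by (simp add: C_def)
  have "0 \<in> C" by (simp add: C_def mem_box_cart)
  obtain \<mu> \<nu> where \<mu>: "\<mu> > 0" "\<And>x u. \<mu> * norm u \<le> speed G x u" by (rule speed_bounds) blast
  let ?K = "C \<times> sphere (0 :: real ^ 'n) 1"
  have "continuous_on ?K (\<lambda>p. speed G (fst p) (snd p))"
    by (intro continuous_speed continuous_intros)
  moreover have "compact ?K" by (intro compact_Times compact_sphere \<open>compact C\<close>)
  ultimately have "uniformly_continuous_on ?K (\<lambda>p. speed G (fst p) (snd p))"
    by (rule compact_uniformly_continuous)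
  then obtain \<eta>1 where \<eta>1: "\<eta>1 > 0" "\<And>p q. p \<in> ?K \<Longrightarrow> q \<in> ?K \<Longrightarrow> dist q p < \<eta>1 \<Longrightarrow>
      dist (speed G (fst q) (snd q)) (speed G (fst p) (snd p)) < \<mu>"
    unfolding uniformly_continuous_on_def using \<mu>(1) by metis
  obtain z where z: "z \<in> C" "\<And>x. x \<in> C \<Longrightarrow> det (G z) \<le> det (G x)"
    using continuous_attains_inf[OF \<open>compact C\<close> _ continuous_det] \<open>0 \<in> C\<close> by blast
  have "uniformly_continuous_on C (\<lambda>x. det (G x))"
    by (rule compact_uniformly_continuous[OF continuous_det \<open>compact C\<close>])
  moreover have "3/4 * det (G z) > 0" using det_pos by simp
  ultimately obtain \<eta>2 where \<eta>2: "\<eta>2 > 0" "\<And>x y. x \<in> C \<Longrightarrow> y \<in> C \<Longrightarrow> dist y x < \<eta>2 \<Longrightarrow>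
      dist (det (G y)) (det (G x)) < 3/4 * det (G z)"
    unfolding uniformly_continuous_on_def by metis
  define \<eta> where "\<eta> = min 1 (min \<eta>1 \<eta>2)"
  have red: "x - lat (cell x) \<in> C \<and> y - lat (cell x) \<in> C" if "dist x y < \<eta>" for x y :: "real ^ 'n"
  proof -
    have "\<bar>x $ i - y $ i\<bar> < 1" for i
      using component_le_norm_cart[of "x - y" i] that by (simp add: dist_norm \<eta>_def)
    then show ?thesis
      using diff_lat_cell_in_fundamental_box[of x]
      by (auto simp: C_def mem_box_cart fundamental_box_def abs_less_iff)
        (smt (verit, best))+
  qed
  show ?thesis
  proof (rule that)
    show "\<eta> > 0" using \<eta>1 \<eta>2 by (simp add: \<eta>_def)
    fix x y :: "real ^ 'n" assume d: "dist x y < \<eta>"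
    let ?x = "x - lat (cell x)" and ?y = "y - lat (cell x)"
    have d': "dist ?y ?x < \<eta>" using d by (simp add: dist_norm norm_minus_commute)
    have "dist (det (G ?y)) (det (G ?x)) < 3/4 * det (G z)"
      using \<eta>2(2)[of ?x ?y] red[OF d] d' by (simp add: \<eta>_def)
    moreover have "det (G z) \<le> det (G ?x)" using z(2) red[OF d] by blast
    ultimately have "det (G ?x) / 4 \<le> det (G ?y)" unfolding dist_real_def by linarith
    then show "det (G x) / 4 \<le> det (G y)" by simp
    fix u :: "real ^ 'n"
    show "speed G y u \<le> 2 * speed G x u"
    proof (cases "u = 0")
      case False
      let ?u = "inverse (norm u) *\<^sub>R u"
      have nu: "norm ?u = 1" using False by simp
      have "dist (?y, ?u) (?x, ?u) = dist ?y ?x" by (simp add: dist_Pair_Pair)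
      then have "dist (speed G ?y ?u) (speed G ?x ?u) < \<mu>"
        using \<eta>1(2)[of "(?x, ?u)" "(?y, ?u)"] red[OF d] d' nu by (simp add: \<eta>_def)
      moreover have "\<mu> \<le> speed G ?x ?u" using \<mu>(2)[of ?u ?x] nu by simp
      ultimately have "speed G ?y ?u \<le> 2 * speed G ?x ?u" unfolding dist_real_def by linarith
      then have "speed G y ?u \<le> 2 * speed G x ?u" by (simp add: speed_def)
      then show ?thesis using False by (simp add: speed_scaleR field_simps)
    qed (simp add: speed_def)
  qed
qed

end

section \<open>Nets and packings\<close>

context periodic_metric
begin

lemma dist_imp_near:
  assumes "\<delta> > 0"
  obtains \<eta> where "\<eta> > 0" "\<And>x y. dist x y < \<eta> \<Longrightarrow> near G \<delta> x y"
proof -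
  obtain \<mu> \<nu> where \<nu>: "\<nu> > 0" "\<And>x u. speed G x u \<le> \<nu> * norm u" by (rule speed_bounds) blast
  show ?thesis
  proof (rule that[of "\<delta> / \<nu>"])
    fix x y :: "real ^ 'n" assume "dist x y < \<delta> / \<nu>"
    then have "\<nu> * norm (y - x) < \<delta>" using \<nu>(1) by (simp add: dist_norm norm_minus_commute field_simps)
    then show "near G \<delta> x y" using near_linepath[OF \<nu>(2)] \<open>\<delta> > 0\<close> by blast
  qed (use \<open>\<delta> > 0\<close> \<nu> in simp)
qed

text \<open>
  A finite set \<open>V\<close> of points that represent a \<open>\<delta>\<close>-separated set in the torus, namely a maximal
  \<open>\<delta>\<close>-separated subset of a finer finite net. The map \<open>lab\<close>
  assigns to a point \<open>x\<close> of \<open>\<real>\<^sup>n\<close> a vertex \<open>v\<close> and a lift \<open>v + lat m\<close> of it that is close to \<open>x\<close>. By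
  construction \<open>m - cell x\<close> takes only finitely many values, so \<open>m\<close> stays at bounded distance from
  the position of \<open>x\<close> in units of \<open>2 * pi\<close>.
\<close>

lemma exists_net:
  assumes "\<delta> > 0"
  obtains V and lab :: "real ^ 'n \<Rightarrow> (real ^ 'n) \<times> (int ^ 'n)" and C where "finite V"
    "\<And>v w m. v \<in> V \<Longrightarrow> w \<in> V \<Longrightarrow> v \<noteq> w \<Longrightarrow> \<not> near G \<delta> v (w + lat m)"
    "\<And>x. fst (lab x) \<in> V" "\<And>x. near G (2 * \<delta>) x (fst (lab x) + lat (snd (lab x)))"
    "\<And>x i. \<bar>of_int (snd (lab x) $ i) - x $ i / (2 * pi)\<bar> \<le> C"
proof -
  obtain \<eta> where \<eta>: "\<eta> > 0" "\<And>x y. dist x y < \<eta> \<Longrightarrow> near G \<delta> x y"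
    using dist_imp_near[OF assms] by blast
  let ?K = "cbox 0 (\<chi> i. 2 * pi) :: (real ^ 'n) set"
  have "\<exists>P. finite P \<and> ?K \<subseteq> (\<Union>p\<in>P. ball p \<eta>)"
    using compact_cbox[of "0 :: real ^ 'n" "\<chi> i. 2 * pi"] \<eta>(1) unfolding compact_eq_totally_bounded
    by blast
  then obtain P where P: "finite P" "?K \<subseteq> (\<Union>p\<in>P. ball p \<eta>)" by blast
  let ?sep = "\<lambda>V. V \<subseteq> P \<and> (\<forall>v\<in>V. \<forall>w\<in>V. \<forall>m. v \<noteq> w \<longrightarrow> \<not> near G \<delta> v (w + lat m))"
  have "\<exists>V. ?sep V \<and> (\<forall>V'. ?sep V' \<longrightarrow> card V' \<le> card V)"
    by (rule ex_has_greatest_nat[of ?sep "{}" card "Suc (card P)"])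
      (use card_mono[OF P(1)] in \<open>auto simp: less_Suc_eq_le\<close>)
  then obtain V where V: "?sep V" and max: "\<And>V'. ?sep V' \<Longrightarrow> card V' \<le> card V" by blast
  have "finite V" using V P(1) finite_subset by blast
  have "\<exists>v m. v \<in> V \<and> near G \<delta> p (v + lat m)" if "p \<in> P" for p
  proof (cases "p \<in> V")
    case True
    then show ?thesis using near_refl[OF assms, of p] by (intro exI[of _ p] exI[of _ 0]) simp
  next
    case False
    define S where "S = insert p V"
    have "card S > card V" using False \<open>finite V\<close> by (simp add: S_def)
    then have "\<not> ?sep S" using max[of S] by linarith
    moreover have "S \<subseteq> P" using V that by (simp add: S_def)
    ultimately obtain v w m where vw: "v \<in> S" "w \<in> S" "v \<noteq> w" "near G \<delta> v (w + lat m)"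
      by blast
    have wv: "near G \<delta> w (v + lat (- m))"
      using near_lat[OF near_sym[OF vw(4)], of "- m"] by simp
    consider "v \<in> V" "w \<in> V" | "v = p" "w \<in> V" | "v \<in> V" "w = p"
      using vw(1-3) unfolding S_def by blast
    then show ?thesis
    proof cases
      case 1
      then show ?thesis using V vw(3,4) by blast
    next
      case 2
      then show ?thesis using vw(4) by blast
    next
      case 3
      then show ?thesis using wv by blast
    qed
  qed
  then obtain f k where fk: "\<And>p. p \<in> P \<Longrightarrow> f p \<in> V" "\<And>p. p \<in> P \<Longrightarrow> near G \<delta> p (f p + lat (k p))"
    by metis
  have "\<exists>p. p \<in> P \<and> dist p (x - lat (cell x)) < \<eta>" for x
  proof -
    have "x - lat (cell x) \<in> ?K" using diff_lat_cell_in_fundamental_box fundamental_box_subset_cbox by blast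
    from subsetD[OF P(2) this] show ?thesis by (blast dest: mem_ball[THEN iffD1])
  qed
  then have "\<forall>x. \<exists>p. p \<in> P \<and> dist p (x - lat (cell x)) < \<eta>" by blast
  from choice[OF this] obtain q where q: "\<And>x. q x \<in> P" "\<And>x. dist (q x) (x - lat (cell x)) < \<eta>"
    by blast
  define lab where "lab x = (f (q x), k (q x) + cell x)" for x
  define C where "C = Max (insert 0 ((\<lambda>(p, i). \<bar>of_int (k p $ i)\<bar>) ` (P \<times> UNIV))) + (1 :: real)"
  have "near G (2 * \<delta>) x (fst (lab x) + lat (snd (lab x)))" for x
  proof -
    have "near G \<delta> (x - lat (cell x)) (q x)" using near_sym[OF \<eta>(2)[OF q(2)]] .
    from near_trans[OF this fk(2)[OF q(1)]]
    have "near G (2 * \<delta>) (x - lat (cell x)) (f (q x) + lat (k (q x)))" by simp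
    from near_lat[OF this, of "cell x"] show ?thesis by (simp add: lab_def add.assoc)
  qed
  moreover have "\<bar>of_int (snd (lab x) $ i) - x $ i / (2 * pi)\<bar> \<le> C" for x i
  proof -
    have "\<bar>of_int (k (q x) $ i)\<bar> \<le> C - 1"
      unfolding C_def add_diff_cancel_right'
      by (rule Max_ge) (use P(1) q(1)[of x] in auto)
    then show ?thesis using cell_bounds[of x i] by (simp add: lab_def)
  qed
  moreover have "fst (lab x) \<in> V" for x using fk(1)[OF q(1)] by (simp add: lab_def)
  moreover have "\<not> near G \<delta> v (w + lat m)" if "v \<in> V" "w \<in> V" "v \<noteq> w" for v w m
    using V that by blast
  ultimately show ?thesis using that[of V lab C] \<open>finite V\<close> by presburger
qed

text \<open>
  The volume of the union of the balls of radius \<open>\<delta> / 2\<close> around the points of a \<open>\<delta>\<close>-separated set.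
  These balls are disjoint in the torus, and each contains an ellipsoid, a ball of radius \<open>\<delta> / 8\<close>
  for the constant metric \<open>G v\<close>, on which the metric is comparable to \<open>G v\<close>.
\<close>

lemma packing_integral:
  assumes "\<mu> > 0" and \<mu>: "\<And>x u. \<mu> * norm u \<le> speed G x u"
    and \<eta>: "\<And>x y u. dist x y < \<eta> \<Longrightarrow> speed G y u \<le> 2 * speed G x u"
      "\<And>x y. dist x y < \<eta> \<Longrightarrow> det (G x) / 4 \<le> det (G y)"
    and "\<delta> > 0" "\<delta> \<le> 8 * \<mu> * \<eta>" "finite U"
    and sep: "\<And>v w m. v \<in> U \<Longrightarrow> w \<in> U \<Longrightarrow> v \<noteq> w \<Longrightarrow> \<not> near G \<delta> v (w + lat m)"
    and lat0: "\<And>x m. near G \<delta> x (x + lat m) \<Longrightarrow> m = 0"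
  shows "ennreal (real (card U) * ((\<delta> / 8) ^ CARD('n) * measure lebesgue (ball (0 :: real ^ 'n) 1) / 2))
    \<le> (\<integral>\<^sup>+x\<in>{x \<in> fundamental_box. \<exists>m. \<exists>v\<in>U. near G (\<delta> / 2) v (x + lat m)}. ennreal (sqrt (det (G x))) \<partial>lborel)"
proof -
  define E where "E v = {y. speed G v (y - v) < \<delta> / 8}" for v
  define \<beta> where "\<beta> = (\<delta> / 8) ^ CARD('n) * measure lebesgue (ball (0 :: real ^ 'n) 1) / 2"
  define F where "F x = ennreal (sqrt (det (G x)))" for x
  have F_meas [measurable]: "F \<in> borel_measurable borel"
  proof -
    have "(\<lambda>x. det (G x)) \<in> borel_measurable borel"
      by (rule borel_measurable_continuous_onI[OF continuous_det])
    then show ?thesis unfolding F_def by measurable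
  qed
  have E_dist: "dist v y < \<eta>" if "y \<in> E v" for v y
  proof -
    have "\<mu> * norm (y - v) < \<mu> * \<eta>"
      using \<mu>[of "y - v" v] that assms(6) by (simp add: E_def)
    then show ?thesis using \<open>\<mu> > 0\<close> by (simp add: dist_norm norm_minus_commute)
  qed
  have E_near: "near G (\<delta> / 2) v y" if "y \<in> E v" for v y
  proof (rule near_linepath)
    fix z assume "z \<in> closed_segment v y"
    then have "dist v z \<le> dist v y" by (metis dist_commute dist_in_closed_segment dist_norm segment_bound(1))
    then have "speed G z (y - v) \<le> 2 * speed G v (y - v)" using E_dist[OF that] by (intro \<eta>(1)) simp
    also have "\<dots> \<le> \<delta> / 4" using that by (simp add: E_def)
    finally show "speed G z (y - v) \<le> \<delta> / 4" .
  qed (use \<open>\<delta> > 0\<close> in auto)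
  have "open (E v)" for v
    unfolding E_def by (intro open_Collect_less continuous_speed continuous_intros)
  then have E_borel [measurable]: "E v \<in> sets borel" for v by simp
  have E_integral: "ennreal \<beta> \<le> (\<integral>\<^sup>+x\<in>E v. F x \<partial>lborel)" for v
  proof -
    note ell = ellipsoid_volume[OF sym pos, of "\<delta> / 8" v v, folded speed_def, folded E_def]
    have "emeasure lborel (E v) = emeasure lebesgue (E v)" by simp
    also have "\<dots> = ennreal (measure lebesgue (E v))"
      using ell(1) \<open>\<delta> > 0\<close> by (simp add: emeasure_eq_measure2)
    finally have em: "emeasure lborel (E v) = ennreal (measure lebesgue (E v))" .
    have \<beta>: "\<beta> = sqrt (det (G v)) / 2 * measure lebesgue (E v)"
      using ell(2) \<open>\<delta> > 0\<close> by (simp add: \<beta>_def)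
    have "ennreal \<beta> = ennreal (sqrt (det (G v)) / 2) * emeasure lborel (E v)"
      unfolding \<beta> em by (rule ennreal_mult') (use det_pos[of v] in simp)
    also have "\<dots> = (\<integral>\<^sup>+x\<in>E v. ennreal (sqrt (det (G v)) / 2) \<partial>lborel)"
      by (simp add: nn_integral_cmult_indicator)
    also have "\<dots> \<le> (\<integral>\<^sup>+x\<in>E v. F x \<partial>lborel)"
    proof (rule nn_integral_mono)
      fix y
      show "ennreal (sqrt (det (G v)) / 2) * indicator (E v) y \<le> F y * indicator (E v) y"
      proof (cases "y \<in> E v")
        case True
        have "sqrt (det (G v) / 4) \<le> sqrt (det (G y))" using \<eta>(2)[OF E_dist[OF True]] by simp
        then have "sqrt (det (G v)) / 2 \<le> sqrt (det (G y))" by (simp add: real_sqrt_divide)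
        then show ?thesis unfolding F_def by (intro mult_right_mono ennreal_leI) auto
      qed simp
    qed
    finally show ?thesis .
  qed
  have unique: "v = w \<and> m = 0" if "v \<in> U" "w \<in> U" "y \<in> E v" "y + lat m \<in> E w" for v w y m
  proof -
    have "near G (\<delta> / 2) y (w + lat (- m))"
      using near_lat[OF near_sym[OF E_near[OF that(4)]], of "- m"] by simp
    from near_trans[OF E_near[OF that(3)] this] have nr: "near G \<delta> v (w + lat (- m))" by simp
    then have "v = w" using sep that(1,2) by blast
    then have "- m = 0" using nr lat0[of v "- m"] by blast
    then show ?thesis using \<open>v = w\<close> by simp
  qed
  define W where "W = (\<Union>v\<in>U. E v)"
  have [measurable]: "W \<in> sets borel" unfolding W_def using \<open>finite U\<close> by (auto intro: sets.finite_UN)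
  have "E v \<subseteq> ball v \<eta>" for v using E_dist by auto
  then have "bounded W"
    unfolding W_def using \<open>finite U\<close> by (intro bounded_UN) (auto intro: bounded_subset[OF bounded_ball])
  have disj: "disjoint_family_on E U"
    unfolding disjoint_family_on_def using unique[of _ _ _ 0] by fastforce
  have "ennreal (real (card U) * \<beta>) = (\<Sum>v\<in>U. ennreal \<beta>)"
    by (simp add: ennreal_mult' ennreal_of_nat_eq_real_of_nat)
  also have "\<dots> \<le> (\<Sum>v\<in>U. \<integral>\<^sup>+x\<in>E v. F x \<partial>lborel)" by (intro sum_mono E_integral)
  also have "\<dots> = (\<integral>\<^sup>+x. (\<Sum>v\<in>U. F x * indicator (E v) x) \<partial>lborel)"
    by (rule nn_integral_sum[symmetric]) measurable
  also have "\<dots> = (\<integral>\<^sup>+x\<in>W. F x \<partial>lborel)"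
    unfolding W_def indicator_UN_disjoint[OF \<open>finite U\<close> disj] by (simp add: sum_distrib_left)
  also have "\<dots> \<le> (\<integral>\<^sup>+x\<in>{x \<in> fundamental_box. \<exists>m. x + lat m \<in> W}. F x \<partial>lborel)"
  proof (rule nn_integral_le_fundamental_box)
    show "m = 0" if "x \<in> W" "x + lat m \<in> W" for x m
    proof -
      obtain v w where "v \<in> U" "x \<in> E v" "w \<in> U" "x + lat m \<in> E w" using \<open>x \<in> W\<close> \<open>x + lat m \<in> W\<close> unfolding W_def by blast
      then show ?thesis using unique by blast
    qed
    show "F (x + lat m) = F x" for x m by (simp add: F_def)
  qed (use F_meas \<open>W \<in> sets borel\<close> \<open>bounded W\<close> in blast)+
  also have "\<dots> \<le> (\<integral>\<^sup>+x\<in>{x \<in> fundamental_box. \<exists>m. \<exists>v\<in>U. near G (\<delta> / 2) v (x + lat m)}. F x \<partial>lborel)"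
  proof (intro nn_integral_mono mult_left_mono)
    fix x
    have "\<exists>v\<in>U. near G (\<delta> / 2) v (x + lat m)" if "x + lat m \<in> W" for m
      using that E_near unfolding W_def by blast
    then show "indicator {x \<in> fundamental_box. \<exists>m. x + lat m \<in> W} x
        \<le> (indicator {x \<in> fundamental_box. \<exists>m. \<exists>v\<in>U. near G (\<delta> / 2) v (x + lat m)} x :: ennreal)"
      by (intro indicator_leI) blast
  qed simp
  finally show ?thesis unfolding \<beta>_def F_def .
qed

text \<open>
  The discrete form of the fact that the product of the \<open>n\<close> degree-one generators of the
  cohomology of the torus is nonzero: the vertices cannot be coloured with the \<open>n\<close> directions in
  such a way that each colour class kills its own direction. Otherwise the coboundary for the
  colour of \<open>x\<close> gives an integer \<open>h x\<close> that is constant on equally coloured nearby points and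
  at bounded distance from the coordinate of \<open>x\<close> in the direction of its colour, in units of \<open>2 * pi\<close>, so
  that the sign of \<open>h\<close> contradicts \<open>no_separating_signed_colouring\<close> on a large cube.
\<close>

lemma net_not_covered_by_killing_sets:
  fixes V :: "(real ^ 'n) set" and lab :: "real ^ 'n \<Rightarrow> (real ^ 'n) \<times> (int ^ 'n)" and c :: "real ^ 'n \<Rightarrow> 'n"
  assumes "\<delta> > 0" "finite V"
    and lab: "\<And>x. fst (lab x) \<in> V" "\<And>x. near G (2 * \<delta>) x (fst (lab x) + lat (snd (lab x)))"
      "\<And>x i. \<bar>of_int (snd (lab x) $ i) - x $ i / (2 * pi)\<bar> \<le> C"
    and kills: "\<And>i. kills (\<lambda>v w m. near G (5 * \<delta>) v (w + lat m)) i {v \<in> V. c v = i}"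
  shows False
proof -
  obtain \<eta> where \<eta>: "\<eta> > 0" "\<And>x y. dist x y < \<eta> \<Longrightarrow> near G \<delta> x y"
    using dist_imp_near[OF assms(1)] by blast
  have "\<forall>i. \<exists>a. \<forall>v\<in>{v \<in> V. c v = i}. \<forall>w\<in>{v \<in> V. c v = i}. \<forall>m.
      near G (5 * \<delta>) v (w + lat m) \<longrightarrow> a v = a w + m $ i"
    using kills unfolding kills_def by blast
  then obtain a :: "'n \<Rightarrow> real ^ 'n \<Rightarrow> int" where a: "\<And>i v w m. v \<in> V \<Longrightarrow> w \<in> V \<Longrightarrow> c v = i \<Longrightarrow> c w = i \<Longrightarrow>
      near G (5 * \<delta>) v (w + lat m) \<Longrightarrow> a i v = a i w + m $ i"
    by (simp add: choice_iff) metis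
  define col where "col x = c (fst (lab x))" for x
  define h where "h x = a (col x) (fst (lab x)) + snd (lab x) $ col x" for x
  define M where "M = Max (insert 0 ((\<lambda>(i, v). \<bar>of_int (a i v)\<bar>) ` (UNIV \<times> V))) + C"
  have h_close: "\<bar>of_int (h x) - x $ col x / (2 * pi)\<bar> \<le> M" for x
  proof -
    have "\<bar>of_int (a (col x) (fst (lab x)))\<bar> \<le> M - C"
      unfolding M_def add_diff_cancel_right'
      by (rule Max_ge) (use assms(2) lab(1)[of x] in auto)
    then show ?thesis using lab(3)[of x "col x"] by (simp add: h_def)
  qed
  \<comment> \<open>So far out that \<open>h x\<close> has the sign of the coordinate of \<open>x\<close>.\<close>
  define L where "L = 2 * pi * (\<bar>M\<bar> + 1) + \<eta>"
  show False
  proof (rule no_separating_signed_colouring[of \<eta> L "\<lambda>x. if h x \<le> 0 then 1 else -1" col])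
    show "L > 0" using \<eta>(1) by (simp add: L_def add_pos_pos)
    fix x y :: "real ^ 'n"
    show "(if h x \<le> 0 then 1 else - 1) = (1 :: real)" if "x $ col x \<le> - L + \<eta>"
    proof -
      have "x $ col x / (2 * pi) \<le> - (\<bar>M\<bar> + 1)" using that by (simp add: L_def field_simps)
      then have "of_int (h x) < (0 :: real)" using h_close[of x] by linarith
      then show ?thesis by simp
    qed
    show "(if h x \<le> 0 then 1 else - 1) = (- 1 :: real)" if "x $ col x \<ge> L - \<eta>"
    proof -
      have "x $ col x / (2 * pi) \<ge> \<bar>M\<bar> + 1" using that by (simp add: L_def field_simps)
      then have "of_int (h x) > (0 :: real)" using h_close[of x] by linarith
      then show ?thesis by simp
    qed
    show "(if h x \<le> 0 then 1 else - 1) = (if h y \<le> 0 then 1 else - 1 :: real)"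
      if d: "dist x y < \<eta>" and col: "col x = col y"
    proof -
      let ?v = "fst (lab x)" and ?w = "fst (lab y)" and ?m = "snd (lab x)" and ?k = "snd (lab y)"
      from near_trans[OF near_trans[OF near_sym[OF lab(2)[of x]] \<eta>(2)[OF d]] lab(2)[of y]]
      have "near G (5 * \<delta>) (?v + lat ?m) (?w + lat ?k)" by (simp add: algebra_simps)
      from near_lat[OF this, of "- ?m"] have "near G (5 * \<delta>) ?v (?w + lat (?k - ?m))" by (simp add: algebra_simps)
      from a[OF lab(1) lab(1) _ _ this, of "col x"] col have "h x = h y"
        by (simp add: h_def col_def)
      then show ?thesis by simp
    qed
  qed (use \<eta>(1) in auto)
qed

end

section \<open>Volumes of balls\<close>

context periodic_metric
begin

text \<open>
  The points that have a lift at distance less than \<open>r\<close> from \<open>x\<close>: the ball around the image of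
  \<open>x\<close> in the torus, described by all its lifts.
\<close>

definition lattice_ball :: "real ^ 'n \<Rightarrow> real \<Rightarrow> (real ^ 'n) set" where
  "lattice_ball x r = {v. \<exists>m. near G r x (v + lat m)}"

text \<open>
  If every translate of a point other than the point itself is at distance at least \<open>2 * r + \<epsilon>\<close>
  from it, then the balls of radius at most \<open>r\<close> kill every direction: each point \<open>v\<close> of such a ball
  around \<open>x\<close> has exactly one lift \<open>v + lat p\<close> near \<open>x\<close>, and the labels are the coboundary of \<open>- p\<close>.
\<close>

lemma layered_graph_lattice_ball:
  assumes "\<epsilon> > 0" and lat0: "\<And>x m. near G (2 * r + \<epsilon>) x (x + lat m) \<Longrightarrow> m = 0"
  shows "layered_graph (\<lambda>v w m. near G \<epsilon> v (w + lat m)) lattice_ball \<epsilon> r"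
proof
  show "near G \<epsilon> w (v + lat (- m))" if "near G \<epsilon> v (w + lat m)" for v w m
    using near_lat[OF near_sym[OF that], of "- m"] by simp
  show "lattice_ball x s \<subseteq> lattice_ball x s'" if "s \<le> s'" for x s s'
    using near_mono[OF _ that] unfolding lattice_ball_def by blast
  show "w \<in> lattice_ball x (s + \<epsilon>)" if v: "v \<in> lattice_ball x s" and "near G \<epsilon> v (w + lat m)" for v w x s m
  proof -
    obtain p where "near G s x (v + lat p)" using v unfolding lattice_ball_def by blast
    from near_trans[OF this near_lat[OF that(2)]]
    have "near G (s + \<epsilon>) x (w + lat (m + p))" by (simp add: add.assoc)
    then show ?thesis unfolding lattice_ball_def by blast
  qed
  show "kills (\<lambda>v w m. near G \<epsilon> v (w + lat m)) i (lattice_ball x s)" if "s \<le> r" for i x s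
  proof -
    have "\<forall>v\<in>lattice_ball x s. \<exists>p. near G s x (v + lat p)" unfolding lattice_ball_def by blast
    then obtain p where p: "\<And>v. v \<in> lattice_ball x s \<Longrightarrow> near G s x (v + lat (p v))" by metis
    show ?thesis
      unfolding kills_def
    proof (intro exI[of _ "\<lambda>v. - p v $ i"] ballI allI impI)
      fix v w m assume v: "v \<in> lattice_ball x s" and w: "w \<in> lattice_ball x s" and nr: "near G \<epsilon> v (w + lat m)"
      from near_trans[OF near_trans[OF near_sym[OF p[OF w]] p[OF v]] near_lat[OF nr]]
      have "near G (s + s + \<epsilon>) (w + lat (p w)) (w + lat (p w) + lat (m + p v - p w))"
        by (simp add: algebra_simps)
      then have "near G (2 * r + \<epsilon>) (w + lat (p w)) (w + lat (p w) + lat (m + p v - p w))"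
        by (rule near_mono) (use that in simp)
      then have "m + p v - p w = 0" by (rule lat0)
      then have "(m + p v - p w) $ i = 0" by simp
      then show "- p v $ i = - p w $ i + m $ i" by simp
    qed
  qed
qed (fact assms(1))

end

text \<open>
  The radius \<open>R\<close> is divided into \<open>n + 2\<close> parts of length \<open>s\<close>: one for the ball around the remaining
  vertex, one for each of the \<open>n\<close> cuts, and one for the balls of radius \<open>\<delta> / 2\<close> around the
  vertices. Each cut uses \<open>N\<close> shells of thickness \<open>5 * \<delta>\<close>, so \<open>s = 5 * N * \<delta>\<close>, and the number \<open>N\<close>
  is chosen so large that \<open>\<delta>\<close> is small against the scale on which the metric varies.
\<close>

lemma riemannian_ball_volume_lower_bound:
  fixes g :: "('n::finite) form_field"
  assumes g: "riemannian_metric g" and "0 < R" and sys: "ennreal R < systole g / 2"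
  shows "\<exists>x\<in>torus. riemannian_volume g (riemannian_ball g x R)
    \<ge> ennreal (measure lebesgue (ball (0 :: real ^ 'n) 1) / (2 * (40 * (real CARD('n) + 2)) ^ CARD('n)) * R ^ CARD('n))"
proof -
  let ?n = "CARD('n)" and ?\<omega> = "measure lebesgue (ball (0 :: real ^ 'n) 1)"
  define G where "G = lifted_metric g"
  interpret periodic_metric G unfolding G_def by (rule periodic_metric_lifted_metric[OF g])
  have "ennreal (2 * R) \<le> systole g"
  proof -
    have "ennreal (2 * R) = ennreal R * 2" using \<open>0 < R\<close> by (simp add: ennreal_mult' mult.commute)
    also have "\<dots> \<le> systole g / 2 * 2" using sys by (intro mult_right_mono) auto
    also have "\<dots> = systole g" by (simp add: ennreal_divide_times)
    finally show ?thesis .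
  qed
  then have lat0: "m = 0" if "near G r x (x + lat m)" "r \<le> 2 * R" for r x m
    using near_lat_systole[OF g, of "2 * R" x m] near_mono[OF that] by (simp add: G_def)
  obtain \<mu> \<nu> where \<mu>: "\<mu> > 0" "\<And>x u. \<mu> * norm u \<le> speed G x u" by (rule speed_bounds) blast
  obtain \<eta> where \<eta>: "\<eta> > 0" "\<And>x y u. dist x y < \<eta> \<Longrightarrow> speed G y u \<le> 2 * speed G x u"
    "\<And>x y. dist x y < \<eta> \<Longrightarrow> det (G x) / 4 \<le> det (G y)"
    by (rule local_comparison) blast
  define s where "s = R / (real ?n + 2)"
  have "s > 0" using \<open>R > 0\<close> by (simp add: s_def)
  have R_eq: "R = (real ?n + 2) * s" by (simp add: s_def)
  obtain N :: nat where N: "s / (40 * \<mu> * \<eta>) < real N" using reals_Archimedean2 by blast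
  have "0 < s / (40 * \<mu> * \<eta>)" using \<open>s > 0\<close> \<mu>(1) \<eta>(1) by simp
  then have "N > 0" using N by (intro gr0I) simp
  define \<delta> where "\<delta> = s / (5 * real N)"
  have "\<delta> > 0" using \<open>s > 0\<close> \<open>N > 0\<close> by (simp add: \<delta>_def)
  have N\<delta>: "real N * (5 * \<delta>) = s" using \<open>N > 0\<close> by (simp add: \<delta>_def)
  have \<delta>_le: "5 * \<delta> \<le> s"
    using \<open>N > 0\<close> \<open>\<delta> > 0\<close> mult_right_mono[of 1 "real N" "5 * \<delta>"] unfolding N\<delta> by simp
  have \<delta>_small: "\<delta> \<le> 8 * \<mu> * \<eta>"
    using N \<mu>(1) \<eta>(1) \<open>N > 0\<close> by (simp add: \<delta>_def field_simps)
  have "s \<le> R" unfolding R_eq using \<open>s > 0\<close> by (simp add: algebra_simps)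
  obtain V and lab :: "real ^ 'n \<Rightarrow> (real ^ 'n) \<times> (int ^ 'n)" and C where V: "finite V"
    "\<And>v w m. v \<in> V \<Longrightarrow> w \<in> V \<Longrightarrow> v \<noteq> w \<Longrightarrow> \<not> near G \<delta> v (w + lat m)"
    and lab: "\<And>x. fst (lab x) \<in> V" "\<And>x. near G (2 * \<delta>) x (fst (lab x) + lat (snd (lab x)))"
    "\<And>x i. \<bar>of_int (snd (lab x) $ i) - x $ i / (2 * pi)\<bar> \<le> C"
    using exists_net[OF \<open>\<delta> > 0\<close>] by blast
  \<comment> \<open>The lifts that \<open>lab\<close> assigns to points at distance less than \<open>\<delta>\<close> are at distance less
    than \<open>2 * \<delta> + \<delta> + 2 * \<delta>\<close>.\<close>
  let ?adj = "\<lambda>v w m. near G (5 * \<delta>) v (w + lat m)"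
  interpret layered_graph ?adj lattice_ball "5 * \<delta>" "R - s"
  proof (rule layered_graph_lattice_ball)
    show "m = 0" if "near G (2 * (R - s) + 5 * \<delta>) x (x + lat m)" for x m
      by (rule lat0[OF that]) (use \<delta>_le \<open>s > 0\<close> in simp)
  qed (use \<open>\<delta> > 0\<close> in simp)
  obtain l :: "'n list" where l: "set l = UNIV" "distinct l" using finite_distinct_list[of "UNIV :: 'n set"] by auto
  then have len: "length l = ?n" by (metis distinct_card)
  obtain Y c where Y: "Y \<subseteq> V" and c: "\<And>i. kills ?adj i {v \<in> V - Y. c v = i}"
    and decay: "\<And>x t. t + real ?n * (real N * (5 * \<delta>)) \<le> R - s \<Longrightarrow>
       N ^ ?n * card (Y \<inter> lattice_ball x t) \<le> card (V \<inter> lattice_ball x (t + real ?n * (real N * (5 * \<delta>))))"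
    using exists_iterated_cut[OF V(1) l(2)] unfolding len l(1) by blast
  have "Y \<noteq> {}"
  proof
    assume "Y = {}"
    then show False using net_not_covered_by_killing_sets[OF \<open>\<delta> > 0\<close> V(1) lab, of c] c by simp
  qed
  then obtain x where "x \<in> Y" by blast
  have radius: "s + real ?n * s = R - s" unfolding R_eq by (simp add: algebra_simps)
  have "near G s x (x + lat 0)" using near_refl[OF \<open>s > 0\<close>] by simp
  then have "x \<in> Y \<inter> lattice_ball x s" using \<open>x \<in> Y\<close> unfolding lattice_ball_def by blast
  moreover have "finite Y" using Y V(1) finite_subset by blast
  ultimately have "1 \<le> card (Y \<inter> lattice_ball x s)"
    by (metis card_gt_0_iff empty_iff finite_Int One_nat_def Suc_leI)
  then have "N ^ ?n \<le> N ^ ?n * card (Y \<inter> lattice_ball x s)" by simp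
  also have "\<dots> \<le> card (V \<inter> lattice_ball x (R - s))"
    using decay[of s x] unfolding N\<delta> radius by simp
  finally have many: "N ^ ?n \<le> card (V \<inter> lattice_ball x (R - s))" .
  define U where "U = V \<inter> lattice_ball x (R - s)"
  have "finite U" using V(1) by (simp add: U_def)
  define D where "D = (40 * (real ?n + 2)) ^ ?n"
  have "real N * (\<delta> / 8) = R / (40 * (real ?n + 2))" using \<open>N > 0\<close> by (simp add: \<delta>_def s_def)
  then have "real N ^ ?n * (\<delta> / 8) ^ ?n = R ^ ?n / D"
    unfolding D_def by (metis power_mult_distrib power_divide)
  then have "R ^ ?n / D * (?\<omega> / 2) = real (N ^ ?n) * ((\<delta> / 8) ^ ?n * ?\<omega> / 2)"
    by (metis mult.assoc of_nat_power times_divide_eq_right)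
  then have "?\<omega> / (2 * D) * R ^ ?n = real (N ^ ?n) * ((\<delta> / 8) ^ ?n * ?\<omega> / 2)" by (simp add: mult.commute)
  also have "\<dots> \<le> real (card U) * ((\<delta> / 8) ^ ?n * ?\<omega> / 2)"
    using many \<open>\<delta> > 0\<close> unfolding U_def by (intro mult_right_mono) auto
  finally have "ennreal (?\<omega> / (2 * D) * R ^ ?n)
      \<le> ennreal (real (card U) * ((\<delta> / 8) ^ ?n * ?\<omega> / 2))" by (rule ennreal_leI)
  also have "\<dots> \<le> (\<integral>\<^sup>+y\<in>{y \<in> fundamental_box. \<exists>m. \<exists>v\<in>U. near G (\<delta> / 2) v (y + lat m)}. ennreal (sqrt (det (G y))) \<partial>lborel)"
  proof (rule packing_integral[OF \<mu> \<eta>(2,3) \<open>\<delta> > 0\<close> \<delta>_small \<open>finite U\<close>])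
    show "\<not> near G \<delta> v (w + lat m)" if "v \<in> U" "w \<in> U" "v \<noteq> w" for v w m
      using V(2) that unfolding U_def by blast
    show "m = 0" if "near G \<delta> y (y + lat m)" for y m
      by (rule lat0[OF that]) (use \<delta>_le \<open>s > 0\<close> \<open>s \<le> R\<close> \<open>\<delta> > 0\<close> in linarith)
  qed
  also have "\<dots> \<le> riemannian_volume g (riemannian_ball g (torus_map x) R)"
    unfolding riemannian_volume_def
  proof (intro nn_integral_mono)
    fix y :: "real ^ 'n"
    have "torus_map y \<in> riemannian_ball g (torus_map x) R" if "v \<in> U" "near G (\<delta> / 2) v (y + lat m)" for v m
    proof -
      obtain p where "near G (R - s) x (v + lat p)" using \<open>v \<in> U\<close> unfolding U_def lattice_ball_def by blast
      from near_trans[OF this near_lat[OF that(2)]] have "near G (R - s + \<delta> / 2) x (y + lat (m + p))"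
        by (simp add: add.assoc)
      then have "near G R x (y + lat (m + p))"
        by (rule near_mono) (use \<delta>_le \<open>\<delta> > 0\<close> in linarith)
      then have "torus_map (y + lat (m + p)) \<in> riemannian_ball g (torus_map x) R"
        unfolding G_def by (rule near_imp_in_riemannian_ball[OF g])
      then show ?thesis by (simp only: torus_map_lat)
    qed
    then show "ennreal (sqrt (det (G y))) * indicator {y \<in> fundamental_box. \<exists>m. \<exists>v\<in>U. near G (\<delta> / 2) v (y + lat m)} y
      \<le> ennreal (sqrt (det (gram g (torus_map y)))) *
        indicator {z. (\<forall>i. 0 \<le> z $ i \<and> z $ i < 2 * pi) \<and> torus_map z \<in> riemannian_ball g (torus_map x) R} y"
      by (auto simp: G_def lifted_metric_def fundamental_box_def split: split_indicator)
  qed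
  finally show ?thesis unfolding D_def using torus_map_in_torus by blast
qed

theorem theorem2:
  shows "\<exists>c::real. c > 0 \<and>
    (\<forall>(g :: ('n::finite) form_field) (R::real).
       riemannian_metric g \<longrightarrow> 0 < R \<longrightarrow> ennreal R < systole g / 2 \<longrightarrow>
       (\<exists>x\<in>torus. riemannian_volume g (riemannian_ball g x R) \<ge> ennreal (c * R ^ CARD('n))))"
proof (intro exI conjI allI impI)
  show "measure lebesgue (ball (0 :: real ^ 'n) 1) / (2 * (40 * (real CARD('n) + 2)) ^ CARD('n)) > 0"
    using content_ball_pos[of 1 "0 :: real ^ 'n"] by simp
qed (rule riemannian_ball_volume_lower_bound)

end
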